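(* Let $\tau\in(0,\infty)$, let $p=p_n$, and let $\mu_n$ be an FvML distribution on $\mathbb{S}^{p_n-1}$ with concentration parameter $\kappa=\tau p_n^{3/4}/\sqrt n$ (and arbitrary location). Let $X,Y$ be two i.i.d. random points on $\mathbb{S}^{p-1}$ (drawn from the measure indicated by the subscript of $\mathbb{P}$). Then for any $u\in\mathbb{R}$, $$n\Big[\mathbb{P}_{\mu_n}\big(\sqrt p\,X^\top Y\le u\big)-\mathbb{P}_{\mu_0}\big(\sqrt p\,X^\top Y\le u\big)\Big]\to\frac{-\tau^2}{\sqrt{2\pi}}\exp(-u^2/2)$$ as $\min\{n,p\}\to\infty$. Moreover, the convergence is uniform in $u$, and consequently $$n\cdot d(\mu_n,\mu_0)\to\frac{\tau^2}{\sqrt{2\pi}} .$$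
   Context: $\mathbb{S}^{p-1}=\{x\in\mathbb{R}^p:\|x\|_2=1\}$ and $\mu_0$ is the uniform distribution on it. The FvML (Fisher--von Mises--Langevin) distribution with concentration $\kappa>0$ and location $\theta\in\mathbb{S}^{p-1}$ has density proportional to $x\mapsto\exp(\kappa\,x^\top\theta)$ with respect to $\mu_0$. For probability measures $\mu,\nu$ on $\mathbb{S}^{p-1}$, $$d(\mu,\nu)=\sup_{t\in[-1,1]}\big|\mathbb{P}_\mu(X_1^\top Y_1\le t)-\mathbb{P}_\nu(X^\top Y\le t)\big|,$$ where $X_1,Y_1$ are drawn independently from $\mu$ and $X,Y$ independently from $\nu$. *)

theory Defs
  imports "HOL-Probability.Probability"
begin

text \<open>The dimension p varies with n, so \<open>\<real>\<^sup>p\<close> is represented by the extensional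
  functions on \<open>{..<p}\<close>, i.e. by the space of the product measure
  \<open>\<Pi>\<^sub>M i\<in>{..<p}. lborel\<close>; the Euclidean norm is \<open>L2_set x {..<p}\<close>.\<close>

definition dot :: "nat \<Rightarrow> (nat \<Rightarrow> real) \<Rightarrow> (nat \<Rightarrow> real) \<Rightarrow> real" where
  "dot p x y = (\<Sum>i<p. x i * y i)"

definition unit_sphere :: "nat \<Rightarrow> (nat \<Rightarrow> real) set" where
  "unit_sphere p = {x \<in> {..<p} \<rightarrow>\<^sub>E UNIV. L2_set x {..<p} = 1}"

definition unit_ball :: "nat \<Rightarrow> (nat \<Rightarrow> real) set" where
  "unit_ball p = {x \<in> {..<p} \<rightarrow>\<^sub>E UNIV. L2_set x {..<p} \<le> 1}"

definition radial_proj :: "nat \<Rightarrow> (nat \<Rightarrow> real) \<Rightarrow> (nat \<Rightarrow> real)" where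
  "radial_proj p x = (\<lambda>i\<in>{..<p}. x i / L2_set x {..<p})"

text \<open>Normalized surface measure on the sphere: the measure of a Borel set A is the
  proportion of the Lebesgue measure of the unit ball lying in the cone over A. The image
  measure lives on all of \<open>\<real>\<^sup>p\<close>; for \<open>p \<ge> 1\<close> it is concentrated on the sphere (only the
  origin, a null set, is projected elsewhere), to which it is then restricted.\<close>

definition uniform_sphere :: "nat \<Rightarrow> (nat \<Rightarrow> real) measure" where
  "uniform_sphere p =
    restrict_space
      (distr (uniform_measure (\<Pi>\<^sub>M i\<in>{..<p}. lborel) (unit_ball p))
         (\<Pi>\<^sub>M i\<in>{..<p}. borel) (radial_proj p))
      (unit_sphere p)"

definition fvml :: "nat \<Rightarrow> real \<Rightarrow> (nat \<Rightarrow> real) \<Rightarrow> (nat \<Rightarrow> real) measure" where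
  "fvml p \<kappa> \<theta> =
    density (uniform_sphere p)
      (\<lambda>x. ennreal (exp (\<kappa> * dot p x \<theta>) / (\<integral>y. exp (\<kappa> * dot p y \<theta>) \<partial>uniform_sphere p)))"

definition dot_dist :: "nat \<Rightarrow> (nat \<Rightarrow> real) measure \<Rightarrow> (nat \<Rightarrow> real) measure \<Rightarrow> real" where
  "dot_dist p \<mu> \<nu> =
    (SUP t\<in>{-1..1}. \<bar>\<P>((x, y) in \<mu> \<Otimes>\<^sub>M \<mu>. dot p x y \<le> t) - \<P>((x, y) in \<nu> \<Otimes>\<^sub>M \<nu>. dot p x y \<le> t)\<bar>)"

end

theory Submission
  imports Defs "HOL-Real_Asymp.Real_Asymp"
begin

text \<open>By reflection invariance the law of \<open>X \<bullet> Y\<close> under an FvML distribution does not depend on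
  the location \<open>\<theta>\<close>. Averaging over \<open>\<theta>\<close> shows that it has density
  \<open>h(t) = G(\<kappa> \<surd>(2 + 2t)) / G(\<kappa>)\<^sup>2\<close> with respect to the law of \<open>T = X \<bullet> Y\<close> under the uniform
  distribution, which is also the law of a single coordinate; here \<open>G(\<kappa>) = E exp(\<kappa> T)\<close>.
  Expanding \<open>G\<close> as a power series with explicit coefficients and comparing with Poisson
  weights yields
  \<open>\<kappa>\<^sup>2/2p - \<kappa>\<^sup>4/4p\<^sup>3 \<le> ln G(\<kappa>) \<le> \<kappa>\<^sup>2/2p\<close>, so that \<open>ln h(T)\<close> differs from
  \<open>\<tau>\<^sup>2 \<surd>p T / n\<close> by at most \<open>4\<tau>\<^sup>4/n\<^sup>2\<close>. Hence \<open>n (h(T) - 1)\<close> is \<open>L\<^sup>1\<close>-close to \<open>\<tau>\<^sup>2 \<surd>p T\<close>, and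
  what remains is the truncated mean of \<open>\<surd>p T\<close>, which is explicit and tends to the
  Gaussian one uniformly in the truncation level.\<close>

text \<open>Nothing relates n to p, so each error must be controlled in n alone or in p alone. The
  exponent 3/4 makes this possible: with a = \<tau>^2 / n it gives k^2 / p = a sqrt p and k^4 / p^3
  = a^2, so the error in ln h is free of p. The linear term arises because the leading exponents k^2
  (2 + 2t) / 2p and 2 k^2 / 2p of numerator and denominator differ by k^2 t / p. The upper bound on
  ln G serves a second time: it bounds the exponential moments of sqrt p T uniformly in p, which
  turns the pointwise expansion of h into an L^1 estimate. The coordinate T is handled through its
  slope v = T / sqrt (1 - T^2), the tangent of the latitude. Its density, proportional to (1 +
  v^2)^(-p/2), is a rescaled Student density with p - 1 degrees of freedom. It is smooth on the
  whole line for every p \<ge> 2, whereas the density of T, proportional to (1 - t^2)^((p-3)/2), is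
  unbounded at the endpoints when p = 2. One explicit family of primitives in v then yields both the
  moments and the truncated means.\<close>

subsection \<open>Householder reflections\<close>

abbreviation lborel_PiM :: "nat set \<Rightarrow> (nat \<Rightarrow> real) measure" where
  "lborel_PiM I \<equiv> Pi\<^sub>M I (\<lambda>_. lborel)"

text \<open>The shift \<open>g x\<close> does not change with coordinate \<open>i\<close>, so after
  Fubini it is constant in the inner integral and the one-dimensional affine substitution
  applies.\<close>

lemma nn_integral_PiM_affine:
  fixes f :: "(nat \<Rightarrow> real) \<Rightarrow> ennreal"
  assumes "finite I" "i \<in> I" "s \<noteq> 0"
    and f[measurable]: "f \<in> borel_measurable (lborel_PiM I)"
    and g[measurable]: "g \<in> borel_measurable (lborel_PiM I)"
    and indep: "\<And>x y. g (x(i := y)) = g x"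
  shows "(\<integral>\<^sup>+x. f (x(i := s * x i + g x)) \<partial>lborel_PiM I)
    = ennreal (1 / \<bar>s\<bar>) * (\<integral>\<^sup>+x. f x \<partial>lborel_PiM I)"
proof -
  interpret product_sigma_finite "\<lambda>_::nat. lborel :: real measure" by standard
  define J where "J = I - {i}"
  have J: "finite J" "i \<notin> J" "I = insert i J" using assms by (auto simp: J_def)
  have i[measurable]: "(\<lambda>x. x i) \<in> borel_measurable (lborel_PiM I)"
    using measurable_component_singleton[of i I "\<lambda>_. lborel :: real measure"] \<open>i \<in> I\<close> by simp
  have m: "(\<lambda>x. x(i := s * x i + g x)) \<in> lborel_PiM I \<rightarrow>\<^sub>M lborel_PiM I"
    using \<open>i \<in> I\<close> by (intro measurable_fun_upd[where J=I]) auto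
  have upd[measurable]: "(\<lambda>y. x(i := y)) \<in> lborel \<rightarrow>\<^sub>M lborel_PiM I" if "x \<in> space
      (lborel_PiM J)" for x
    using that J by (intro measurable_fun_upd[where J=J]) auto
  have "(\<integral>\<^sup>+x. f (x(i := s * x i + g x)) \<partial>lborel_PiM I)
      = (\<integral>\<^sup>+x. \<integral>\<^sup>+y. f (x(i := g x + s * y)) \<partial>lborel \<partial>lborel_PiM J)"
    using product_nn_integral_insert[OF J(1,2), of "\<lambda>x. f (x(i := s * x i + g x))"]
      measurable_compose[OF m f] J(3) by (simp add: indep add.commute)
  also have "\<dots> = (\<integral>\<^sup>+x. ennreal (1 / \<bar>s\<bar>) * \<integral>\<^sup>+y. f (x(i := y)) \<partial>lborel \<partial>lborel_PiM J)"
  proof (rule nn_integral_cong)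
    fix x assume x: "x \<in> space (lborel_PiM J)"
    have [measurable]: "(\<lambda>y. f (x(i := y))) \<in> borel_measurable borel"
      using measurable_compose[OF upd[OF x] f] by simp
    show "(\<integral>\<^sup>+y. f (x(i := g x + s * y)) \<partial>lborel) = ennreal (1 / \<bar>s\<bar>) * \<integral>\<^sup>+y. f (x(i := y)) \<partial>lborel"
      by (subst nn_integral_real_affine[OF _ \<open>s \<noteq> 0\<close>, of "\<lambda>y. f (x(i := y))" "g x"])
        (use \<open>s \<noteq> 0\<close> in \<open>auto simp: mult.assoc[symmetric] ennreal_mult[symmetric]\<close>)
  qed
  also have "\<dots> = ennreal (1 / \<bar>s\<bar>) * (\<integral>\<^sup>+x. \<integral>\<^sup>+y. f (x(i := y)) \<partial>lborel \<partial>lborel_PiM J)"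
  proof (rule nn_integral_cmult)
    have "(\<lambda>(x, y). x(i := y)) \<in> lborel_PiM J \<Otimes>\<^sub>M lborel \<rightarrow>\<^sub>M lborel_PiM I"
      using J by (auto intro!: measurable_fun_upd[where J=J] simp: split_beta')
    from measurable_compose[OF this f]
    have [measurable]: "(\<lambda>(x, y). f (x(i := y))) \<in> borel_measurable (lborel_PiM J \<Otimes>\<^sub>M lborel)"
      by (simp add: split_beta')
    show "(\<lambda>x. \<integral>\<^sup>+y. f (x(i := y)) \<partial>lborel) \<in> borel_measurable (lborel_PiM J)"
      by measurable
  qed
  also have "(\<integral>\<^sup>+x. \<integral>\<^sup>+y. f (x(i := y)) \<partial>lborel \<partial>lborel_PiM J) = (\<integral>\<^sup>+x. f x \<partial>lborel_PiM I)"
    using product_nn_integral_insert[OF J(1,2), of f] f J(3) by simp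
  finally show ?thesis .
qed

lemma measurable_PiM_lborel_component:
  "i \<in> I \<Longrightarrow> (\<lambda>x. x i) \<in> borel_measurable (lborel_PiM I)"
  using measurable_component_singleton[of i I "\<lambda>_. lborel :: real measure"] by simp

lemma measurable_PiM_lborel_partial:
  assumes "J \<subseteq> I" "g \<in> borel_measurable (lborel_PiM I)"
  shows "(\<lambda>x i. if i \<in> J then s * x i + c i * g x else x i) \<in> lborel_PiM I \<rightarrow>\<^sub>M lborel_PiM I"
proof (rule measurable_PiM_single')
  fix i assume "i \<in> I"
  note [measurable] = assms(2) measurable_PiM_lborel_component[OF \<open>i \<in> I\<close>]
  show "(\<lambda>x. if i \<in> J then s * x i + c i * g x else x i) \<in> lborel_PiM I \<rightarrow>\<^sub>M lborel"
    by (cases "i \<in> J") (simp_all add: borel_measurable_add borel_measurable_times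
      assms(2) measurable_PiM_lborel_component[OF \<open>i \<in> I\<close>])
qed (use assms in \<open>auto simp: space_PiM PiE_iff extensional_def\<close>)

text \<open>The coordinates in \<open>J\<close> are transformed one at a time. As \<open>g\<close>
  reads only coordinates outside \<open>J\<close>, its value is unaffected by the steps already
  made.\<close>

lemma nn_integral_PiM_affine_partial:
  fixes f :: "(nat \<Rightarrow> real) \<Rightarrow> ennreal"
  assumes "finite I" "J \<subseteq> I" "s \<noteq> 0"
    and "f \<in> borel_measurable (lborel_PiM I)"
    and g[measurable]: "g \<in> borel_measurable (lborel_PiM I)"
    and "\<And>x y. (\<And>i. i \<notin> J \<Longrightarrow> x i = y i) \<Longrightarrow> g x = g y"
  shows "(\<integral>\<^sup>+x. f (\<lambda>i. if i \<in> J then s * x i + c i * g x else x i) \<partial>lborel_PiM I)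
    = ennreal (1 / \<bar>s\<bar> ^ card J) * (\<integral>\<^sup>+x. f x \<partial>lborel_PiM I)"
proof -
  have "finite J" using assms finite_subset by blast
  then show ?thesis using assms(2,4,6)
  proof (induction J arbitrary: f rule: finite_induct)
    case empty
    then show ?case by simp
  next
    case (insert j J)
    define A where "A x = x(j := s * x j + c j * g x)" for x
    have j[measurable]: "(\<lambda>x. x j) \<in> borel_measurable (lborel_PiM I)"
      using insert.prems(1) by (intro measurable_PiM_lborel_component) auto
    have A[measurable]: "A \<in> lborel_PiM I \<rightarrow>\<^sub>M lborel_PiM I"
      unfolding A_def[abs_def] using insert.prems(1) by (intro measurable_fun_upd[where J=I]) auto
    note [measurable] = insert.prems(2)
    have *: "(\<lambda>i. if i \<in> insert j J then s * x i + c i * g x else x i)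
        = A (\<lambda>i. if i \<in> J then s * x i + c i * g x else x i)" for x
    proof -
      have "g (\<lambda>i. if i \<in> J then s * x i + c i * g x else x i) = g x"
        by (rule insert.prems(3)) auto
      then show ?thesis using insert.hyps by (auto simp: A_def)
    qed
    have "(\<integral>\<^sup>+x. f (\<lambda>i. if i \<in> insert j J then s * x i + c i * g x else x i) \<partial>lborel_PiM I)
      = ennreal (1 / \<bar>s\<bar> ^ card J) * (\<integral>\<^sup>+x. f (A x) \<partial>lborel_PiM I)"
      unfolding *
    proof (rule insert.IH)
      fix x y :: "nat \<Rightarrow> real"
      assume "\<And>i. i \<notin> J \<Longrightarrow> x i = y i"
      then show "g x = g y" by (intro insert.prems(3)) auto
    qed (use insert.prems(1) in auto)
    also have "(\<integral>\<^sup>+x. f (A x) \<partial>lborel_PiM I) = ennreal (1 / \<bar>s\<bar>) * (\<integral>\<^sup>+x. f x \<partial>lborel_PiM I)"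
      unfolding A_def
    proof (rule nn_integral_PiM_affine)
      fix x y
      have "g (x(j := y)) = g x" by (rule insert.prems(3)) auto
      then show "c j * g (x(j := y)) = c j * g x" by simp
    qed (use assms(1,3) insert.prems(1,2) in auto)
    finally show ?case
      using insert.hyps \<open>s \<noteq> 0\<close>
      by (simp add: mult.assoc[symmetric] ennreal_mult[symmetric] mult.commute)
  qed
qed

text \<open>For \<open>a = 0\<close> the quotient is \<open>0\<close>, so \<open>reflect p 0\<close> is the identity.\<close>

definition reflect :: "nat \<Rightarrow> (nat \<Rightarrow> real) \<Rightarrow> (nat \<Rightarrow> real) \<Rightarrow> (nat \<Rightarrow> real)" where
  "reflect p a x = (\<lambda>i\<in>{..<p}. x i - 2 * dot p a x / dot p a a * a i)"

lemma dot_commute: "dot p x y = dot p y x"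
  by (simp add: dot_def mult.commute)

lemma dot_nonneg: "0 \<le> dot p x x"
  by (simp add: dot_def sum_nonneg)

lemma measurable_dot[measurable]:
  "(\<lambda>x. dot p a x) \<in> borel_measurable (lborel_PiM {..<p})"
  unfolding dot_def by (intro borel_measurable_sum borel_measurable_times
      measurable_PiM_lborel_component) auto

lemma measurable_reflect:
  "reflect p a \<in> lborel_PiM {..<p} \<rightarrow>\<^sub>M lborel_PiM {..<p}"
  unfolding reflect_def[abs_def]
proof (rule measurable_restrict)
  fix i assume "i \<in> {..<p}"
  then have [measurable]: "(\<lambda>x. x i) \<in> borel_measurable (lborel_PiM {..<p})"
    by (rule measurable_PiM_lborel_component)
  show "(\<lambda>x. x i - 2 * dot p a x / dot p a a * a i) \<in> lborel_PiM {..<p} \<rightarrow>\<^sub>M lborel"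
    by measurable
qed

lemma dot_eq_remove:
  assumes "i < p"
  shows "dot p a x = a i * x i + (\<Sum>j\<in>{..<p} - {i}. a j * x j)"
  unfolding dot_def using assms by (subst sum.remove[of _ i]) auto

text \<open>With \<open>a i \<noteq> 0\<close>, the reflection is a product of shears: replace \<open>x i\<close> by \<open>a \<bullet> x\<close>, correct
  the other coordinates by multiples of this number, and recover the coordinate \<open>i\<close> from
  the fact that the reflection changes the sign of \<open>a \<bullet> x\<close>.\<close>

lemma nn_integral_reflect:
  fixes f :: "(nat \<Rightarrow> real) \<Rightarrow> ennreal"
  assumes f[measurable]: "f \<in> borel_measurable (lborel_PiM {..<p})"
  shows "(\<integral>\<^sup>+x. f (reflect p a x) \<partial>lborel_PiM {..<p}) = (\<integral>\<^sup>+x. f x \<partial>lborel_PiM {..<p})"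
proof (cases "\<exists>i<p. a i \<noteq> 0")
  case False
  then have "reflect p a x = x" if "x \<in> space (lborel_PiM {..<p})" for x
    using that by (auto simp: reflect_def space_PiM PiE_iff extensional_def restrict_def fun_eq_iff)
  then show ?thesis by (intro nn_integral_cong) simp
next
  case True
  then obtain i where i: "i < p" "a i \<noteq> 0" by blast
  define L where "L = lborel_PiM {..<p}"
  define g where "g x = (\<Sum>j\<in>{..<p} - {i}. a j * x j)" for x :: "nat \<Rightarrow> real"
  define c where "c = 2 / dot p a a"
  define A where "A x = x(i := a i * x i + g x)" for x :: "nat \<Rightarrow> real"
  define B where "B x = (\<lambda>j. if j \<in> {..<p} - {i} then 1 * x j + (- c * a j) * x i else x j)"
    for x :: "nat \<Rightarrow> real"
  define C where "C x = x(i := (- 1 / a i) * x i + (- 1 / a i) * g x)" for x :: "nat \<Rightarrow> real"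
  have "dot p a a \<noteq> 0"
    unfolding dot_def using i by (subst sum_nonneg_eq_0_iff) auto
  have xi[measurable]: "(\<lambda>x. x i) \<in> borel_measurable L"
    unfolding L_def using i by (intro measurable_PiM_lborel_component) auto
  have g[measurable]: "g \<in> borel_measurable L"
    unfolding g_def[abs_def] L_def
    by (intro borel_measurable_sum borel_measurable_times measurable_PiM_lborel_component) auto
  have fL[measurable]: "f \<in> borel_measurable L" using f by (simp add: L_def)
  have [measurable]: "C \<in> L \<rightarrow>\<^sub>M L"
    unfolding C_def[abs_def] L_def using i xi[unfolded L_def] g[unfolded L_def]
    by (intro measurable_fun_upd[where J="{..<p}"]) auto
  have [measurable]: "B \<in> L \<rightarrow>\<^sub>M L"
    unfolding B_def[abs_def] L_def
    by (rule measurable_PiM_lborel_partial) (use xi[unfolded L_def] in auto)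
  have g_upd: "g (x(i := y)) = g x" for x y by (simp add: g_def)
  have refl: "reflect p a x = C (B (A x))" if "x \<in> space L" for x
  proof
    fix j
    have a_dot: "a i * x i + g x = dot p a x" using i by (simp add: g_def dot_eq_remove)
    have cN: "c * dot p a x * dot p a a = 2 * dot p a x" using \<open>dot p a a \<noteq> 0\<close> by (simp add: c_def)
    have Ai: "A x i = dot p a x" by (simp add: A_def a_dot)
    have "g (B (A x)) = (\<Sum>j\<in>{..<p} - {i}. a j * x j - c * dot p a x * (a j * a j))"
      unfolding g_def B_def using Ai by (intro sum.cong) (auto simp: A_def algebra_simps)
    also have "\<dots> = g x - c * dot p a x * (dot p a a - a i * a i)"
      using i by (simp add: g_def sum_subtractf sum_distrib_left[symmetric] dot_eq_remove)
    also have "\<dots> = g x - 2 * dot p a x + c * dot p a x * (a i * a i)"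
      by (simp only: right_diff_distrib cN)
    finally have gB: "g (B (A x)) = g x - 2 * dot p a x + c * dot p a x * (a i * a i)" .
    have BAi: "B (A x) i = dot p a x" by (simp add: B_def A_def a_dot)
    consider "j = i" | "j \<noteq> i" "j < p" | "\<not> j < p" by blast
    then show "reflect p a x j = C (B (A x)) j"
    proof cases
      case 1
      have "C (B (A x)) i = - (dot p a x + g (B (A x))) / a i"
        by (simp add: C_def BAi divide_inverse algebra_simps)
      also have "\<dots> = (a i * x i - c * dot p a x * (a i * a i)) / a i"
        unfolding gB a_dot[symmetric] by (simp add: algebra_simps)
      also have "\<dots> = x i - c * dot p a x * a i" using i by (simp add: field_simps)
      finally show ?thesis using 1 i by (simp add: reflect_def c_def)
    next
      case 2
      then show ?thesis by (simp add: reflect_def C_def B_def A_def c_def a_dot)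
    next
      case 3
      then show ?thesis using i that
        by (auto simp: reflect_def C_def B_def A_def L_def space_PiM PiE_iff extensional_def)
    qed
  qed
  have "(\<integral>\<^sup>+x. f (reflect p a x) \<partial>L) = (\<integral>\<^sup>+x. f (C (B (A x))) \<partial>L)"
    by (intro nn_integral_cong) (simp add: refl)
  also have "\<dots> = ennreal (1 / \<bar>a i\<bar>) * (\<integral>\<^sup>+x. f (C (B x)) \<partial>L)"
    unfolding A_def L_def
    by (rule nn_integral_PiM_affine[where f="\<lambda>x. f (C (B x))"])
      (use i g in \<open>simp_all only: g_upd\<close>, auto simp: L_def[symmetric])
  also have "(\<integral>\<^sup>+x. f (C (B x)) \<partial>L) = (\<integral>\<^sup>+x. f (C x) \<partial>L)"
  proof -
    have "(\<integral>\<^sup>+x. f (C (B x)) \<partial>L) = ennreal (1 / \<bar>1\<bar> ^ card ({..<p} - {i})) * (\<integral>\<^sup>+x. f (C x) \<partial>L)"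
      unfolding B_def L_def
      by (rule nn_integral_PiM_affine_partial[where f="\<lambda>x. f (C x)"]) (auto simp: L_def[symmetric])
    then show ?thesis by simp
  qed
  also have "(\<integral>\<^sup>+x. f (C x) \<partial>L) = ennreal (1 / \<bar>- 1 / a i\<bar>) * (\<integral>\<^sup>+x. f x \<partial>L)"
    unfolding C_def L_def
    by (rule nn_integral_PiM_affine) (use i g in \<open>simp_all only: g_upd\<close>, auto simp:
        L_def[symmetric])
  \<comment> \<open>The factors 1 / |a i| from \<open>A\<close> and |a i| from \<open>C\<close>
    cancel.\<close>
  finally show ?thesis using i
    by (simp add: mult.assoc[symmetric] ennreal_mult[symmetric] L_def)
qed

subsection \<open>The uniform distribution on the sphere\<close>

lemma L2_set_eq_sqrt_dot: "L2_set x {..<p} = sqrt (dot p x x)"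
  by (simp add: L2_set_def dot_def power2_eq_square)

lemma dot_diff_left: "dot p (\<lambda>i. x i - y i) z = dot p x z - dot p y z"
  by (simp add: dot_def left_diff_distrib sum_subtractf)

lemma dot_restrict[simp]:
  "dot p (restrict x {..<p}) y = dot p x y" "dot p x (restrict y {..<p}) = dot p x y"
  by (simp_all add: dot_def)

lemma dot_divide_right: "dot p x (\<lambda>i. y i / c) = dot p x y / c"
  by (simp add: dot_def sum_divide_distrib)

lemma dot_eq_0_iff: "dot p x x = 0 \<longleftrightarrow> (\<forall>i<p. x i = 0)"
  by (auto simp: dot_def sum_nonneg_eq_0_iff)

lemma unit_sphere_iff: "x \<in> unit_sphere p \<longleftrightarrow> x \<in> extensional {..<p} \<and> dot p x x = 1"
  by (auto simp: unit_sphere_def L2_set_eq_sqrt_dot PiE_def)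

lemma unit_ball_iff: "x \<in> unit_ball p \<longleftrightarrow> x \<in> extensional {..<p} \<and> dot p x x \<le> 1"
  by (auto simp: unit_ball_def L2_set_eq_sqrt_dot PiE_def)

lemma radial_proj_eq: "radial_proj p x = (\<lambda>i\<in>{..<p}. x i / sqrt (dot p x x))"
  by (simp add: radial_proj_def L2_set_eq_sqrt_dot)

lemma dot_radial_proj: "dot p a (radial_proj p x) = dot p a x / sqrt (dot p x x)"
  by (simp add: radial_proj_eq dot_divide_right)

lemma dot_radial_proj_self: "dot p (radial_proj p x) (radial_proj p x) = (if dot p x x
    = 0 then 0 else 1)"
  using dot_nonneg[of p x]
  by (simp add: dot_radial_proj dot_commute[of p "radial_proj p x"])

lemma radial_proj_in_sphere_iff: "radial_proj p x \<in> unit_sphere p \<longleftrightarrow> dot p x x \<noteq> 0"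
  by (simp add: unit_sphere_iff dot_radial_proj_self) (simp add: radial_proj_eq)

lemma reflect_extensional[simp]: "reflect p a x \<in> extensional {..<p}"
  by (simp add: reflect_def)

lemma dot_reflect: "dot p (reflect p a x) (reflect p a y) = dot p x y"
proof -
  define c where "c = 2 / dot p a a"
  have "dot p (reflect p a x) (reflect p a y)
    = (\<Sum>i<p. x i * y i - c * dot p a y * (a i * x i) - c * dot p a x * (a i * y i)
        + c * c * dot p a x * dot p a y * (a i * a i))"
    unfolding reflect_def dot_restrict c_def
    unfolding dot_def by (intro sum.cong) (simp_all add: algebra_simps)
  also have "\<dots> = dot p x y - c * dot p a y * dot p a x - c * dot p a x * dot p a y
        + c * dot p a x * dot p a y * (c * dot p a a)"
    by (simp add: sum.distrib sum_subtractf sum_distrib_left[symmetric] dot_def[symmetric])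
  \<comment> \<open>The last factor \<open>c * dot p a a\<close> is 2 when \<open>a\<close> has
    nonzero norm. Otherwise \<open>c\<close> is 0 by division by zero and the three correction terms
    vanish.\<close>
  also have "\<dots> = dot p x y"
    by (simp add: c_def)
  finally show ?thesis .
qed

lemma reflect_radial_proj: "radial_proj p (reflect p a x) = reflect p a (radial_proj p x)"
proof
  fix i
  show "radial_proj p (reflect p a x) i = reflect p a (radial_proj p x) i"
  proof (cases "i < p")
    case True
    then show ?thesis
      unfolding radial_proj_eq[of p "reflect p a x"] dot_reflect
      unfolding reflect_def dot_radial_proj
      by (simp add: radial_proj_eq diff_divide_distrib)
  next
    case False
    then show ?thesis by (simp add: radial_proj_eq reflect_def)
  qed
qed

text \<open>Vectors of equal norm are mirror images in the hyperplane bisecting them: with a = x -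
  y, equality of norms gives \<open>dot p a a = 2 * dot p a x\<close>, so the coefficient in
  \<open>reflect\<close> is 1. If x = y, the reflection is the identity.\<close>

lemma reflect_swap:
  assumes "x \<in> extensional {..<p}" "y \<in> extensional {..<p}" "dot p x x = dot p y y"
  shows "reflect p (\<lambda>i. x i - y i) x = y"
proof
  fix i
  define a where "a = (\<lambda>i. x i - y i)"
  have eq: "dot p a a = 2 * dot p a x"
    using assms(3) by (simp add: a_def dot_diff_left dot_commute[of p _ "\<lambda>i. x i
        - y i"] dot_commute[of p y x])
  show "reflect p a x i = y i"
  proof (cases "i < p")
    case True
    show ?thesis
    proof (cases "dot p a a = 0")
      case True
      then have "a i = 0" using \<open>i < p\<close> by (simp add: dot_eq_0_iff)
      then show ?thesis using \<open>i < p\<close> by (simp add: reflect_def) (simp add: a_def)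
    next
      case False
      then show ?thesis using \<open>i < p\<close> by (simp add: reflect_def eq[symmetric]) (simp add: a_def)
    qed
  next
    case False
    then show ?thesis using assms by (auto simp: reflect_def extensional_def)
  qed
qed

lemma sets_lborel_PiM: "sets (lborel_PiM I) = sets (Pi\<^sub>M I (\<lambda>_. borel))"
  by (intro sets_PiM_cong) auto

lemma measurable_dot2[measurable (raw)]:
  assumes "x \<in> M \<rightarrow>\<^sub>M Pi\<^sub>M {..<p} (\<lambda>_. borel)" "y \<in> M \<rightarrow>\<^sub>M Pi\<^sub>M {..<p} (\<lambda>_. borel)"
  shows "(\<lambda>w. dot p (x w) (y w)) \<in> borel_measurable M"
  unfolding dot_def
  by (intro borel_measurable_sum borel_measurable_times
      measurable_compose[OF assms(1) measurable_component_singleton]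
      measurable_compose[OF assms(2) measurable_component_singleton]) auto

lemma measurable_dot_const[measurable]:
  "(\<lambda>x. dot p a x) \<in> borel_measurable (Pi\<^sub>M {..<p} (\<lambda>_. borel))"
  unfolding dot_def by (intro borel_measurable_sum borel_measurable_times) auto

lemma sets_unit_sphere[measurable]: "unit_sphere p \<in> sets (Pi\<^sub>M {..<p} (\<lambda>_. borel))"
proof -
  have "unit_sphere p = {x \<in> space (Pi\<^sub>M {..<p} (\<lambda>_. borel)). dot p x x = 1}"
    by (auto simp: unit_sphere_iff space_PiM PiE_def)
  also have "\<dots> \<in> sets (Pi\<^sub>M {..<p} (\<lambda>_. borel))" by measurable
  finally show ?thesis .
qed

lemma sets_unit_ball[measurable]: "unit_ball p \<in> sets (lborel_PiM {..<p})"
proof -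
  have "unit_ball p = {x \<in> space (Pi\<^sub>M {..<p} (\<lambda>_. borel)). dot p x x \<le> 1}"
    by (auto simp: unit_ball_iff space_PiM PiE_def)
  also have "\<dots> \<in> sets (Pi\<^sub>M {..<p} (\<lambda>_. borel))" by measurable
  finally show ?thesis by (simp add: sets_lborel_PiM)
qed

lemma measurable_radial_proj[measurable]:
  "radial_proj p \<in> lborel_PiM {..<p} \<rightarrow>\<^sub>M Pi\<^sub>M {..<p} (\<lambda>_. borel)"
proof -
  have "(\<lambda>x. dot p x x) \<in> borel_measurable (Pi\<^sub>M {..<p} (\<lambda>_. borel))"
    by measurable
  then have "(\<lambda>x. \<lambda>i\<in>{..<p}. x i / sqrt (dot p x x))
      \<in> Pi\<^sub>M {..<p} (\<lambda>_. borel) \<rightarrow>\<^sub>M Pi\<^sub>M {..<p} (\<lambda>_. borel)"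
    by (intro measurable_restrict borel_measurable_divide borel_measurable_sqrt
        measurable_component_singleton) auto
  then show ?thesis
    unfolding radial_proj_eq[abs_def]
    by (subst measurable_cong_sets[OF sets_lborel_PiM refl])
qed

lemma sets_uniform_sphere[measurable_cong]:
  "sets (uniform_sphere p) = sets (restrict_space (Pi\<^sub>M {..<p} (\<lambda>_. borel)) (unit_sphere p))"
  unfolding uniform_sphere_def by (intro restrict_space_sets_cong) auto

lemma space_uniform_sphere: "space (uniform_sphere p) = unit_sphere p"
proof -
  have "unit_sphere p \<subseteq> space (Pi\<^sub>M {..<p} (\<lambda>_. borel :: real measure))"
    using sets_unit_sphere by (rule sets.sets_into_space)
  then show ?thesis
    by (simp add: uniform_sphere_def space_restrict_space Int_absorb2)
qed

lemma measurable_uniform_sphereI: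
  "f \<in> Pi\<^sub>M {..<p} (\<lambda>_. borel) \<rightarrow>\<^sub>M N \<Longrightarrow> f \<in> uniform_sphere p \<rightarrow>\<^sub>M N"
  by (subst measurable_cong_sets[OF sets_uniform_sphere refl]) (rule measurable_restrict_space1)

text \<open>At the origin \<open>radial_proj\<close> returns the zero vector, because of division by
  zero. The restriction to the sphere removes this point, which is why the indicator excludes
  \<open>dot p x x = 0\<close>.\<close>

lemma nn_integral_uniform_sphere:
  assumes f[measurable]: "f \<in> borel_measurable (Pi\<^sub>M {..<p} (\<lambda>_. borel))"
  shows "(\<integral>\<^sup>+x. f x \<partial>uniform_sphere p) =
    (\<integral>\<^sup>+x. f (radial_proj p x) * indicator {x. dot p x x \<noteq> 0 \<and> dot p x x \<le> 1} x \<partial>lborel_PiM {..<p})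
      / emeasure (lborel_PiM {..<p}) (unit_ball p)"
proof -
  let ?B = "Pi\<^sub>M {..<p} (\<lambda>_. borel) :: (nat \<Rightarrow> real) measure"
  let ?U = "uniform_measure (lborel_PiM {..<p}) (unit_ball p)"
  have [measurable]: "radial_proj p \<in> ?U \<rightarrow>\<^sub>M ?B"
    using measurable_radial_proj by (simp cong: measurable_cong_sets)
  have g: "(\<lambda>x. f x * indicator (unit_sphere p) x) \<in> borel_measurable ?B"
    by measurable
  have "(\<integral>\<^sup>+x. f x \<partial>uniform_sphere p)
      = (\<integral>\<^sup>+x. f x * indicator (unit_sphere p) x \<partial>distr ?U ?B (radial_proj p))"
    unfolding uniform_sphere_def by (rule nn_integral_restrict_space) auto
  also have "\<dots> = (\<integral>\<^sup>+x. f (radial_proj p x) * indicator (unit_sphere p) (radial_proj p x) \<partial>?U)"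
    by (subst nn_integral_distr) (use g in auto)
  also have "\<dots> = (\<integral>\<^sup>+x. f (radial_proj p x) * indicator (unit_sphere p) (radial_proj p x)
        * indicator (unit_ball p) x \<partial>lborel_PiM {..<p}) / emeasure (lborel_PiM {..<p})
            (unit_ball p)"
    by (rule nn_integral_uniform_measure) (use measurable_compose[OF measurable_radial_proj g] in
        auto)
  also have "(\<integral>\<^sup>+x. f (radial_proj p x) * indicator (unit_sphere p) (radial_proj p x)
        * indicator (unit_ball p) x \<partial>lborel_PiM {..<p})
      = (\<integral>\<^sup>+x. f (radial_proj p x) * indicator {x. dot p x x \<noteq> 0 \<and> dot p x x
          \<le> 1} x \<partial>lborel_PiM {..<p})"
    by (intro nn_integral_cong)
      (auto simp: indicator_def radial_proj_in_sphere_iff unit_ball_iff space_PiM PiE_def)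
  finally show ?thesis .
qed

text \<open>Reflections commute with radial projection and preserve \<open>dot p x x\<close>, so the
  invariance of Lebesgue measure descends to the cone measure.\<close>

lemma nn_integral_uniform_sphere_reflect:
  assumes f[measurable]: "f \<in> borel_measurable (Pi\<^sub>M {..<p} (\<lambda>_. borel))"
  shows "(\<integral>\<^sup>+x. f (reflect p a x) \<partial>uniform_sphere p) = (\<integral>\<^sup>+x. f x \<partial>uniform_sphere p)"
proof -
  let ?g = "\<lambda>x. f (radial_proj p x) * indicator {x. dot p x x \<noteq> 0 \<and> dot p x x \<le> 1} x"
  have r: "reflect p a \<in> Pi\<^sub>M {..<p} (\<lambda>_. borel) \<rightarrow>\<^sub>M Pi\<^sub>M {..<p} (\<lambda>_. borel)"
    using measurable_reflect[of p a]
    by (subst (asm) measurable_cong_sets[OF sets_lborel_PiM sets_lborel_PiM])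
  have "{x \<in> space (Pi\<^sub>M {..<p} (\<lambda>_. borel)). dot p x x \<noteq> 0 \<and> dot p x x \<le> 1}
      \<in> sets (Pi\<^sub>M {..<p} (\<lambda>_. borel))"
    by measurable
  then have "{x \<in> space (lborel_PiM {..<p}). dot p x x \<noteq> 0 \<and> dot p x x
      \<le> 1} \<in> sets (lborel_PiM {..<p})"
    by (simp add: sets_lborel_PiM space_PiM)
  then have "(\<lambda>x. indicator {x. dot p x x \<noteq> 0 \<and> dot p x x \<le> 1} x :: ennreal)
      \<in> borel_measurable (lborel_PiM {..<p})"
    by (subst borel_measurable_indicator_iff) (simp add: Int_def conj_commute)
  then have g: "?g \<in> borel_measurable (lborel_PiM {..<p})"
    by (intro borel_measurable_times_ennreal measurable_compose[OF measurable_radial_proj f])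
  have "(\<integral>\<^sup>+x. ?g (reflect p a x) \<partial>lborel_PiM {..<p}) = (\<integral>\<^sup>+x. ?g x \<partial>lborel_PiM {..<p})"
    by (rule nn_integral_reflect[OF g])
  then show ?thesis
    using nn_integral_uniform_sphere[OF f]
      nn_integral_uniform_sphere[OF measurable_compose[OF r f]]
    by (simp add: reflect_radial_proj indicator_def dot_reflect)
qed

text \<open>The ball lies between the cubes with sides [0, 1 / sqrt p] and [-1, 1]. Positivity and
  finiteness make the division in \<open>uniform_measure\<close> a genuine normalization.\<close>

lemma emeasure_unit_ball:
  assumes "p \<ge> 1"
  shows "emeasure (lborel_PiM {..<p}) (unit_ball p) \<noteq> 0"
    "emeasure (lborel_PiM {..<p}) (unit_ball p) \<noteq> \<infinity>"
proof -
  interpret product_sigma_finite "\<lambda>_::nat. lborel :: real measure" by standard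
  have "(\<Pi>\<^sub>E i\<in>{..<p}. {0..1 / sqrt (real p)}) \<subseteq> unit_ball p"
  proof
    fix x assume x: "x \<in> (\<Pi>\<^sub>E i\<in>{..<p}. {0..1 / sqrt (real p)})"
    have "dot p x x \<le> (\<Sum>i<p. 1 / sqrt (real p) * (1 / sqrt (real p)))"
      unfolding dot_def using x by (intro sum_mono mult_mono) (auto simp: PiE_iff)
    also have "\<dots> = 1" using assms by simp
    finally show "x \<in> unit_ball p" using x by (simp add: unit_ball_iff PiE_def)
  qed
  then have "emeasure (lborel_PiM {..<p}) (\<Pi>\<^sub>E i\<in>{..<p}. {0..1 / sqrt (real p)})
      \<le> emeasure (lborel_PiM {..<p}) (unit_ball p)"
    by (intro emeasure_mono) auto
  moreover have "emeasure (lborel_PiM {..<p}) (\<Pi>\<^sub>E i\<in>{..<p}. {0..1 / sqrt (real p)})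
      = ennreal (1 / sqrt (real p)) ^ p"
    by (subst emeasure_PiM) auto
  moreover have "ennreal (1 / sqrt (real p)) ^ p > 0" using assms by (simp add: ennreal_power)
  ultimately show "emeasure (lborel_PiM {..<p}) (unit_ball p) \<noteq> 0" by auto
  have "unit_ball p \<subseteq> (\<Pi>\<^sub>E i\<in>{..<p}. {-1..1})"
  proof
    fix x assume x: "x \<in> unit_ball p"
    have "\<bar>x i\<bar> \<le> 1" if "i < p" for i
    proof -
      have "(x i)\<^sup>2 \<le> dot p x x"
        unfolding dot_def power2_eq_square using that by (intro member_le_sum) auto
      then have "(x i)\<^sup>2 \<le> 1" using x by (simp add: unit_ball_iff)
      then show ?thesis by (simp add: abs_square_le_1)
    qed
    then show "x \<in> (\<Pi>\<^sub>E i\<in>{..<p}. {-1..1})"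
      using x by (auto simp: unit_ball_iff PiE_def abs_le_iff minus_le_iff)
  qed
  then have "emeasure (lborel_PiM {..<p}) (unit_ball p)
      \<le> emeasure (lborel_PiM {..<p}) (\<Pi>\<^sub>E i\<in>{..<p}. {-1..1})"
    by (intro emeasure_mono sets_PiM_I_finite) auto
  also have "\<dots> = 2 ^ p"
    by (subst emeasure_PiM) auto
  finally show "emeasure (lborel_PiM {..<p}) (unit_ball p) \<noteq> \<infinity>"
    by (auto simp: top_unique power_eq_top_ennreal)
qed

subsection \<open>The law of one coordinate\<close>

lemma dot_upd_0:
  assumes "p \<ge> 1"
  shows "dot p (y(0 := t)) (y(0 := t)) = t\<^sup>2 + (\<Sum>i\<in>{1..<p}. (y i)\<^sup>2)"
proof -
  have "{..<p} = insert 0 {1..<p}" using assms by auto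
  then show ?thesis by (simp add: dot_def power2_eq_square)
qed

lemma AE_dot_self_nonzero:
  assumes "p \<ge> 1"
  shows "AE x in lborel_PiM {..<p}. dot p x x \<noteq> 0"
proof (rule AE_I)
  interpret product_sigma_finite "\<lambda>_::nat. lborel :: real measure" by standard
  show "{x \<in> space (lborel_PiM {..<p}). \<not> dot p x x \<noteq> 0} \<subseteq> (\<Pi>\<^sub>E i\<in>{..<p}. {0})"
    by (auto simp: dot_eq_0_iff space_PiM PiE_iff extensional_def restrict_def fun_eq_iff)
  show "emeasure (lborel_PiM {..<p}) (\<Pi>\<^sub>E i\<in>{..<p}. {0}) = 0"
    using assms by (subst emeasure_PiM) (auto simp: power_0_left)
qed (rule sets_PiM_I_finite, auto)

lemma prob_space_uniform_sphere:
  assumes "p \<ge> 1"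
  shows "prob_space (uniform_sphere p)"
proof
  let ?L = "lborel_PiM {..<p}"
  have "emeasure (uniform_sphere p) (space (uniform_sphere p)) = (\<integral>\<^sup>+x. 1 \<partial>uniform_sphere p)"
    by simp
  also have "\<dots> = (\<integral>\<^sup>+x. 1 * indicator {x. dot p x x \<noteq> 0 \<and> dot p x x \<le> 1} x \<partial>?L)
      / emeasure ?L (unit_ball p)"
    by (rule nn_integral_uniform_sphere) simp
  also have "(\<integral>\<^sup>+x. 1 * indicator {x. dot p x x \<noteq> 0 \<and> dot p x x \<le> 1} x \<partial>?L)
      = (\<integral>\<^sup>+x. indicator (unit_ball p) x \<partial>?L)"
    using AE_dot_self_nonzero[OF assms] AE_space
    by (intro nn_integral_cong_AE, eventually_elim)
      (auto simp: indicator_def unit_ball_iff space_PiM PiE_def)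
  also have "\<dots> = emeasure ?L (unit_ball p)" by simp
  also have "\<dots> / emeasure ?L (unit_ball p) = 1"
    using emeasure_unit_ball[OF assms] by (simp add: ennreal_divide_self top.not_eq_extremum)
  finally show "emeasure (uniform_sphere p) (space (uniform_sphere p)) = 1" .
qed

text \<open>\<open>lat v\<close> is the first coordinate of a unit vector whose first coordinate is \<open>v\<close> times the
  norm of the remaining ones; \<open>slope_measure p\<close> is the law of this ratio \<open>v\<close>.\<close>

definition lat :: "real \<Rightarrow> real" where
  "lat v = v / sqrt (1 + v\<^sup>2)"

definition slope_measure :: "nat \<Rightarrow> real measure" where
  "slope_measure p = density lborel (\<lambda>v. ennreal ((1 + v\<^sup>2) powr (- real p / 2)
     / (\<integral>w. (1 + w\<^sup>2) powr (- real p / 2) \<partial>lborel)))"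

lemma one_plus_square_pos: "0 < 1 + (v::real)\<^sup>2"
  by (simp add: add_pos_nonneg)

lemma measurable_lat[measurable]: "lat \<in> borel_measurable borel"
  unfolding lat_def[abs_def] by measurable

lemma abs_lat_less_1: "\<bar>lat v\<bar> < 1"
proof -
  have "\<bar>v\<bar> < sqrt (1 + v\<^sup>2)" by (rule real_less_rsqrt) simp
  then show ?thesis
    using one_plus_square_pos[of v] by (simp add: lat_def abs_divide divide_less_eq)
qed

text \<open>Substitute \<open>x 0 = r * v\<close>, with \<open>r\<close> the norm of the other coordinates \<open>y\<close>, and then
  rescale \<open>y\<close> by \<open>sqrt (1 + v\<^sup>2)\<close>.\<close>

lemma nn_integral_uniform_sphere_coordinate:
  assumes "p \<ge> 2"
  obtains K where "\<And>F. F \<in> borel_measurable borel \<Longrightarrow>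
    (\<integral>\<^sup>+x. F (x 0) \<partial>uniform_sphere p)
      = K * (\<integral>\<^sup>+v. F (lat v) * ennreal ((1 + v\<^sup>2) powr (- real p / 2)) \<partial>lborel)"
proof -
  interpret product_sigma_finite "\<lambda>_::nat. lborel :: real measure" by standard
  define J where "J = {1..<p}"
  have J: "finite J" "0 \<notin> J" "{..<p} = insert 0 J" "card J = p - 1"
    using assms by (auto simp: J_def)
  interpret LJ: sigma_finite_measure "lborel_PiM J" using J by (intro sigma_finite)
  interpret P: pair_sigma_finite lborel "lborel_PiM J" ..
  define r where "r y = sqrt (\<Sum>i\<in>J. (y i)\<^sup>2)" for y :: "nat \<Rightarrow> real"
  have r_nonneg: "0 \<le> r y" for y by (simp add: r_def sum_nonneg)
  have r_sq: "(r y)\<^sup>2 = (\<Sum>i\<in>J. (y i)\<^sup>2)" for y by (simp add: r_def sum_nonneg)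
  have r[measurable]: "r \<in> borel_measurable (lborel_PiM J)"
    unfolding r_def[abs_def]
    by (intro measurable_compose[OF _ borel_measurable_sqrt] borel_measurable_sum
        borel_measurable_power
        measurable_PiM_lborel_component)
  \<comment> \<open>\<open>J\<close> has p - 1 \<ge> 1 elements, so the zero vector is null; the
    substitution t = r y * v below needs \<open>r y > 0\<close>.\<close>
  have r_AE: "AE y in lborel_PiM J. r y > 0"
  proof (rule AE_I)
    show "{y \<in> space (lborel_PiM J). \<not> r y > 0} \<subseteq> (\<Pi>\<^sub>E i\<in>J. {0})"
    proof
      fix y assume "y \<in> {y \<in> space (lborel_PiM J). \<not> r y > 0}"
      then have y: "y \<in> space (lborel_PiM J)" "\<not> r y > 0" by auto
      then have "(\<Sum>i\<in>J. (y i)\<^sup>2) = 0"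
        using r_nonneg[of y] r_sq[of y] by (simp add: not_less)
      then show "y \<in> (\<Pi>\<^sub>E i\<in>J. {0})"
        using y J by (auto simp: sum_nonneg_eq_0_iff space_PiM PiE_iff extensional_def
            restrict_def fun_eq_iff)
    qed
    show "emeasure (lborel_PiM J) (\<Pi>\<^sub>E i\<in>J. {0}) = 0"
      using J assms by (subst emeasure_PiM) (auto simp: power_0_left)
  qed (rule sets_PiM_I_finite[OF J(1)], simp)
  define K0 where "K0 = (\<integral>\<^sup>+y. ennreal (r y) * indicator {..1} (r y) \<partial>lborel_PiM J)"
  define V where "V = emeasure (lborel_PiM {..<p}) (unit_ball p)"
  \<comment> \<open>Rescaling the p - 1 coordinates by s = sqrt (1 + v^2) contributes s^(-(p-1)),
    and the factor \<open>r y\<close>, which is the Jacobian of the first substitution, contributes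
    one more 1 / s. This is the origin of the exponent -p/2.\<close>
  have inner: "(\<integral>\<^sup>+y. ennreal (r y) * indicator {..1} (sqrt (1 + v\<^sup>2) * r y) \<partial>lborel_PiM J)
      = ennreal ((1 + v\<^sup>2) powr (- real p / 2)) * K0" for v
  proof -
    define s where "s = sqrt (1 + v\<^sup>2)"
    have s: "s > 0" by (simp add: s_def one_plus_square_pos)
    have rs: "r (\<lambda>i. if i \<in> J then s * y i + 0 * 0 else y i) = s * r y" for y
      using s by (simp add: r_def power_mult_distrib sum_distrib_left[symmetric] real_sqrt_mult)
    have "(\<integral>\<^sup>+y. ennreal (s * r y) * indicator {..1} (s * r y) \<partial>lborel_PiM J)
      = ennreal (1 / \<bar>s\<bar> ^ card J) * K0"
      using nn_integral_PiM_affine_partial[OF J(1) subset_refl, of s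
        "\<lambda>y. ennreal (r y) * indicator {..1} (r y)" "\<lambda>_. 0" "\<lambda>_. 0"] s
      unfolding rs K0_def by simp
    then have "ennreal s * (\<integral>\<^sup>+y. ennreal (r y) * indicator {..1} (s * r y) \<partial>lborel_PiM J)
      = ennreal (1 / s ^ (p - 1)) * K0"
      using s r_nonneg by (subst nn_integral_cmult[symmetric])
        (auto simp: ennreal_mult mult.assoc J)
    then have "ennreal (1 / s) * (ennreal s * (\<integral>\<^sup>+y. ennreal (r y) * indicator {..1} (s
        * r y) \<partial>lborel_PiM J))
      = ennreal (1 / s) * (ennreal (1 / s ^ (p - 1)) * K0)" by simp
    moreover have "ennreal (1 / s) * ennreal (1 / s ^ (p - 1))
        = ennreal ((1 + v\<^sup>2) powr (- real p / 2))"
    proof -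
      have "1 / s * (1 / s ^ (p - 1)) = 1 / s ^ p"
        using s assms by (simp add: power_eq_if)
      also have "\<dots> = s powr (- real p)"
        using s by (simp add: powr_minus powr_realpow divide_inverse)
      also have "\<dots> = (1 + v\<^sup>2) powr (- real p / 2)"
        by (simp add: s_def powr_half_sqrt[symmetric] powr_powr)
      finally show ?thesis using s by (simp add: ennreal_mult[symmetric])
    qed
    ultimately show ?thesis
      using s by (simp add: mult.assoc[symmetric] ennreal_mult[symmetric] s_def[symmetric])
  qed
  show ?thesis
  proof
    fix F :: "real \<Rightarrow> ennreal" assume F[measurable]: "F \<in> borel_measurable borel"
    define h where "h t R = F (t / sqrt (t\<^sup>2 + R\<^sup>2)) * indicator {x. x \<noteq> 0 \<and> x \<le> 1} (t\<^sup>2 + R\<^sup>2)"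
      for t R :: real
    have h[measurable]: "(\<lambda>(t, R). h t R) \<in> borel_measurable (borel \<Otimes>\<^sub>M borel)"
      unfolding h_def by measurable
    have x0: "(\<lambda>x. x 0) \<in> borel_measurable (lborel_PiM {..<p})"
      using assms by (intro measurable_PiM_lborel_component) auto
    have rp[measurable]: "r \<in> borel_measurable (lborel_PiM {..<p})"
      unfolding r_def[abs_def] using J(3)
      by (intro measurable_compose[OF _ borel_measurable_sqrt] borel_measurable_sum
          borel_measurable_power
          measurable_PiM_lborel_component) auto
    have dot_p: "dot p x x = (x 0)\<^sup>2 + (r x)\<^sup>2" for x
      using dot_upd_0[of p x "x 0"] assms by (simp add: r_sq J_def)
    have "(\<lambda>x. F (x 0)) \<in> borel_measurable (Pi\<^sub>M {..<p} (\<lambda>_. borel))"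
      using assms by (intro measurable_compose[OF _ F] measurable_component_singleton) auto
    then have "(\<integral>\<^sup>+x. F (x 0) \<partial>uniform_sphere p)
        = (\<integral>\<^sup>+x. h (x 0) (r x) \<partial>lborel_PiM {..<p}) / V"
      using assms by (subst nn_integral_uniform_sphere)
        (auto simp: V_def h_def dot_p radial_proj_eq indicator_def cong: if_cong)
    also have "(\<integral>\<^sup>+x. h (x 0) (r x) \<partial>lborel_PiM {..<p})
        = (\<integral>\<^sup>+y. \<integral>\<^sup>+t. h t (r y) \<partial>lborel \<partial>lborel_PiM J)"
    proof -
      have "r (y(0 := t)) = r y" for y t
        unfolding r_def using J(2) by (intro arg_cong[where f=sqrt] sum.cong) auto
      moreover have "(\<lambda>x. h (x 0) (r x)) \<in> borel_measurable (lborel_PiM {..<p})"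
        using measurable_compose[OF measurable_Pair[OF x0 rp] h] by simp
      ultimately show ?thesis
        using product_nn_integral_insert[OF J(1,2), of "\<lambda>x. h (x 0) (r x)"] J(3) by simp
    qed
    also have "\<dots> = (\<integral>\<^sup>+y. \<integral>\<^sup>+v. F (lat v) * (ennreal (r y) * indicator {..1} (sqrt (1
        + v\<^sup>2) * r y)) \<partial>lborel \<partial>lborel_PiM J)"
    proof (rule nn_integral_cong_AE, use r_AE in eventually_elim)
      fix y :: "nat \<Rightarrow> real" assume y: "r y > 0"
      \<comment> \<open>The ball condition t^2 + r^2 \<le> 1 becomes sqrt (1 + v^2) r \<le> 1, and
        the ratio t / sqrt (t^2 + r^2) becomes \<open>lat v\<close>.\<close>
      have sq: "(r y * v)\<^sup>2 + (r y)\<^sup>2 = (sqrt (1 + v\<^sup>2) * r y)\<^sup>2" for v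
        using one_plus_square_pos[of v] by (simp add: power_mult_distrib algebra_simps)
      have "h (r y * v) (r y) = F (lat v) * indicator {..1} (sqrt (1 + v\<^sup>2) * r y)" for v
      proof -
        have pos: "sqrt (1 + v\<^sup>2) * r y > 0" using y one_plus_square_pos[of v] by simp
        have "r y * v / sqrt ((r y * v)\<^sup>2 + (r y)\<^sup>2) = lat v"
          unfolding sq using pos y by (simp add: lat_def)
        moreover have "(sqrt (1 + v\<^sup>2) * r y)\<^sup>2 \<le> 1 \<longleftrightarrow> sqrt (1 + v\<^sup>2) * r y \<le> 1"
          using pos by (simp only: abs_square_le_1 abs_of_pos)
        ultimately show ?thesis
          unfolding h_def using pos y one_plus_square_pos[of v] by (auto simp: sq indicator_def)
      qed
      then have "(\<integral>\<^sup>+t. h t (r y) \<partial>lborel) = ennreal (r y) * (\<integral>\<^sup>+v. F (lat v) * indicator {..1}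
          (sqrt (1 + v\<^sup>2) * r y) \<partial>lborel)"
        using nn_integral_real_affine[of "\<lambda>t. h t (r y)" "r y" 0] y by simp
      also have "\<dots> = (\<integral>\<^sup>+v. F (lat v) * (ennreal (r y) * indicator {..1} (sqrt (1
          + v\<^sup>2) * r y)) \<partial>lborel)"
        by (subst nn_integral_cmult[symmetric]) (auto simp: ac_simps)
      finally show "(\<integral>\<^sup>+t. h t (r y) \<partial>lborel) = \<dots>" .
    qed
    also have "\<dots> = (\<integral>\<^sup>+v. \<integral>\<^sup>+y. F (lat v) * (ennreal (r y) * indicator {..1} (sqrt (1
        + v\<^sup>2) * r y)) \<partial>lborel_PiM J \<partial>lborel)"
      by (rule P.Fubini') measurable
    also have "\<dots> = (\<integral>\<^sup>+v. K0 * (F (lat v) * ennreal ((1 + v\<^sup>2) powr (- real p / 2))) \<partial>lborel)"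
    proof (rule nn_integral_cong)
      fix v
      show "(\<integral>\<^sup>+y. F (lat v) * (ennreal (r y) * indicator {..1} (sqrt (1
          + v\<^sup>2) * r y)) \<partial>lborel_PiM J)
        = K0 * (F (lat v) * ennreal ((1 + v\<^sup>2) powr (- real p / 2)))"
        by (subst nn_integral_cmult) (measurable, simp only: inner, simp only: mult_ac)
    qed
    also have "\<dots> = K0 * (\<integral>\<^sup>+v. F (lat v) * ennreal ((1 + v\<^sup>2) powr (- real p / 2)) \<partial>lborel)"
      by (rule nn_integral_cmult) measurable
    finally show "(\<integral>\<^sup>+x. F (x 0) \<partial>uniform_sphere p)
      = K0 / V * (\<integral>\<^sup>+v. F (lat v) * ennreal ((1 + v\<^sup>2) powr (- real p / 2)) \<partial>lborel)"
      by (simp add: divide_ennreal_def ac_simps)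
  qed
qed

text \<open>For p \<ge> 2 the integrand is dominated by the Cauchy kernel 1 / (1 + v^2).\<close>

lemma integrable_slope_density:
  assumes "p \<ge> 2"
  shows "integrable lborel (\<lambda>v::real. (1 + v\<^sup>2) powr (- real p / 2))"
proof (rule Bochner_Integration.integrable_bound)
  show "integrable lborel (\<lambda>v::real. inverse (1 + v\<^sup>2))"
    using integrable_inverse_1_plus_square by (simp add: set_integrable_def)
  have "(1 + v\<^sup>2) powr (- real p / 2) \<le> (1 + v\<^sup>2) powr (- 1)" for v :: real
    using assms by (intro powr_mono) auto
  then show "AE v in lborel. norm ((1 + v\<^sup>2) powr (- real p / 2))
      \<le> norm (inverse (1 + v\<^sup>2))" for v :: real
    using one_plus_square_pos by (auto simp: powr_minus)
qed measurable

lemma slope_normalizer_pos: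
  assumes "p \<ge> 2"
  shows "(\<integral>v. (1 + v\<^sup>2) powr (- real p / 2) \<partial>lborel) > 0"
proof -
  have "(\<integral>v. (1 + v\<^sup>2) powr (- real p / 2) \<partial>lborel) \<noteq> 0"
  proof
    assume "(\<integral>v. (1 + v\<^sup>2) powr (- real p / 2) \<partial>lborel) = 0"
    then have "AE v in lborel. (1 + v\<^sup>2) powr (- real p / 2) = (0::real)"
      by (subst (asm) integral_nonneg_eq_0_iff_AE) (use integrable_slope_density[OF assms] in auto)
    then have "AE v in (lborel :: real measure). False"
    proof eventually_elim
      case (elim v)
      then show ?case using one_plus_square_pos[of v] by simp
    qed
    then show False by (simp add: AE_iff_null null_sets_def)
  qed
  moreover have "(\<integral>v. (1 + v\<^sup>2) powr (- real p / 2) \<partial>lborel) \<ge> 0"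
    by (intro integral_nonneg_AE) auto
  ultimately show ?thesis by (metis less_le)
qed

lemma nn_integral_slope_measure:
  assumes "f \<in> borel_measurable borel"
  shows "(\<integral>\<^sup>+v. f v \<partial>slope_measure p) = (\<integral>\<^sup>+v. ennreal ((1 + v\<^sup>2) powr (- real p / 2)
     / (\<integral>w. (1 + w\<^sup>2) powr (- real p / 2) \<partial>lborel)) * f v \<partial>lborel)"
  unfolding slope_measure_def using assms by (subst nn_integral_density) auto

lemma sets_slope_measure[measurable_cong, simp]: "sets (slope_measure p) = sets borel"
  by (simp add: slope_measure_def)

lemma space_slope_measure[simp]: "space (slope_measure p) = UNIV"
  by (simp add: slope_measure_def)

lemma prob_space_slope_measure:
  assumes "p \<ge> 2"
  shows "prob_space (slope_measure p)"
proof
  have "emeasure (slope_measure p) (space (slope_measure p)) = (\<integral>\<^sup>+v. 1 \<partial>slope_measure p)"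
    by simp
  also have "\<dots> = ennreal (\<integral>v. (1 + v\<^sup>2) powr (- real p / 2)
     / (\<integral>w. (1 + w\<^sup>2) powr (- real p / 2) \<partial>lborel) \<partial>lborel)"
    using integrable_slope_density[OF assms] slope_normalizer_pos[OF assms]
    by (subst nn_integral_slope_measure, simp, simp only: mult_1_right, intro
        nn_integral_eq_integral) auto
  also have "\<dots> = 1"
    using slope_normalizer_pos[OF assms] by simp
  finally show "emeasure (slope_measure p) (space (slope_measure p)) = 1" .
qed

text \<open>The preceding coordinate formula gives proportionality. Taking \<open>F\<close>
  constantly 1, where the left side is the total mass 1, identifies the constant as the reciprocal
  of the normalizer.\<close>

lemma nn_integral_uniform_sphere_slope:
  assumes "p \<ge> 2" and F[measurable]: "F \<in> borel_measurable borel"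
  shows "(\<integral>\<^sup>+x. F (x 0) \<partial>uniform_sphere p) = (\<integral>\<^sup>+v. F (lat v) \<partial>slope_measure p)"
proof -
  define N where "N = (\<integral>w. (1 + w\<^sup>2) powr (- real p / 2) \<partial>lborel)"
  have N: "N > 0" using slope_normalizer_pos[OF assms(1)] by (simp add: N_def)
  obtain K where K: "\<And>F. F \<in> borel_measurable borel \<Longrightarrow>
    (\<integral>\<^sup>+x. F (x 0) \<partial>uniform_sphere p)
      = K * (\<integral>\<^sup>+v. F (lat v) * ennreal ((1 + v\<^sup>2) powr (- real p / 2)) \<partial>lborel)"
    using nn_integral_uniform_sphere_coordinate[OF assms(1)] by blast
  interpret prob_space "uniform_sphere p" using assms by (intro prob_space_uniform_sphere) auto
  have "1 = K * (\<integral>\<^sup>+v. ennreal ((1 + v\<^sup>2) powr (- real p / 2)) \<partial>lborel)"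
    using K[of "\<lambda>_. 1"] by (simp add: emeasure_space_1)
  also have "(\<integral>\<^sup>+v. ennreal ((1 + v\<^sup>2) powr (- real p / 2)) \<partial>lborel) = ennreal N"
    unfolding N_def using integrable_slope_density[OF assms(1)]
        by (intro nn_integral_eq_integral) auto
  finally have KN: "K * ennreal N = 1" by simp
  have "K = K * (ennreal N * ennreal (1 / N))"
    using N by (simp add: ennreal_mult[symmetric])
  then have K_eq: "K = ennreal (1 / N)" using KN by (simp add: mult.assoc[symmetric])
  have w: "ennreal ((1 + v\<^sup>2) powr (- real p / 2) / N)
      = ennreal (1 / N) * ennreal ((1 + v\<^sup>2) powr (- real p / 2))" for v
    using N by (simp add: ennreal_mult[symmetric])
  have "(\<integral>\<^sup>+v. F (lat v) \<partial>slope_measure p)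
      = (\<integral>\<^sup>+v. ennreal (1 / N) * (F (lat v) * ennreal ((1 + v\<^sup>2) powr (- real p / 2))) \<partial>lborel)"
    by (subst nn_integral_slope_measure) (simp, simp only: N_def[symmetric] w mult_ac)
  also have "\<dots> = (\<integral>\<^sup>+x. F (x 0) \<partial>uniform_sphere p)"
    unfolding K[OF F] K_eq by (rule nn_integral_cmult) measurable
  finally show ?thesis by simp
qed

subsection \<open>Reduction to a one-dimensional integral\<close>

text \<open>This is also the normalizing constant of the FvML density. It equals the hypergeometric
  function 0F1 with parameter p/2 at k^2/4, that is, a rescaled modified Bessel function of order
  p/2 - 1.\<close>

definition lat_mgf :: "nat \<Rightarrow> real \<Rightarrow> real" where
  "lat_mgf p k = (\<integral>v. exp (k * lat v) \<partial>slope_measure p)"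

lemma integrable_slope_measure_lat:
  fixes f :: "real \<Rightarrow> real"
  assumes "p \<ge> 2" and [measurable]: "f \<in> borel_measurable borel"
    and "\<And>x. \<bar>x\<bar> \<le> 1 \<Longrightarrow> \<bar>f x\<bar> \<le> B"
  shows "integrable (slope_measure p) (\<lambda>v. f (lat v))"
proof -
  interpret prob_space "slope_measure p" using assms(1) by (rule prob_space_slope_measure)
  show ?thesis
    by (intro integrable_const_bound[of _ B]) (auto intro!: assms(3) less_imp_le[OF abs_lat_less_1])
qed

lemma measure_slope_measure_UNIV[simp]: "p \<ge> 2 \<Longrightarrow> measure (slope_measure p) UNIV = 1"
  using prob_space.prob_space[OF prob_space_slope_measure, of p] by simp

lemma lat_mgf_0: "p \<ge> 2 \<Longrightarrow> lat_mgf p 0 = 1"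
  by (simp add: lat_mgf_def)

lemma integrable_exp_lat:
  assumes "p \<ge> 2"
  shows "integrable (slope_measure p) (\<lambda>v. exp (k * lat v))"
proof (rule integrable_slope_measure_lat[OF assms])
  fix x :: real assume "\<bar>x\<bar> \<le> 1"
  then have "\<bar>k\<bar> * \<bar>x\<bar> \<le> \<bar>k\<bar> * 1" by (intro mult_left_mono) auto
  then show "\<bar>exp (k * x)\<bar> \<le> exp \<bar>k\<bar>"
    using abs_ge_self[of "k * x"] by (simp add: abs_mult)
qed measurable

lemma nn_integral_exp_lat:
  assumes "p \<ge> 2"
  shows "(\<integral>\<^sup>+v. ennreal (exp (k * lat v)) \<partial>slope_measure p) = ennreal (lat_mgf p k)"
  unfolding lat_mgf_def using integrable_exp_lat[OF assms] by (intro nn_integral_eq_integral) auto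

lemma lat_mgf_pos:
  assumes "p \<ge> 2"
  shows "lat_mgf p k > 0"
proof -
  interpret prob_space "slope_measure p" using assms by (rule prob_space_slope_measure)
  have "exp (- \<bar>k\<bar>) = (\<integral>v. exp (- \<bar>k\<bar>) \<partial>slope_measure p)" using assms by simp
  also have "\<dots> \<le> lat_mgf p k"
    unfolding lat_mgf_def
  proof (rule integral_mono)
    fix v
    have "\<bar>k * lat v\<bar> \<le> \<bar>k\<bar> * 1"
      unfolding abs_mult using abs_lat_less_1[of v] by (intro mult_left_mono) auto
    then show "exp (- \<bar>k\<bar>) \<le> exp (k * lat v)" by (simp add: abs_le_iff)
  qed (use integrable_exp_lat[OF assms] in auto)
  finally show ?thesis by (metis exp_gt_zero less_le_trans)
qed

lemma measurable_lat_mgf[measurable]: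
  assumes "p \<ge> 2"
  shows "lat_mgf p \<in> borel_measurable borel"
proof -
  interpret prob_space "slope_measure p" using assms by (rule prob_space_slope_measure)
  show ?thesis unfolding lat_mgf_def[abs_def] by measurable
qed

definition pole :: "nat \<Rightarrow> nat \<Rightarrow> real" where
  "pole p = (\<lambda>i\<in>{..<p}. if i = 0 then 1 else 0)"

lemma dot_pole:
  assumes "p \<ge> 1"
  shows "dot p (pole p) x = x 0"
proof -
  have "{..<p} = insert 0 {1..<p}" using assms by auto
  then show ?thesis by (simp add: dot_def pole_def)
qed

lemma pole_sphere: "p \<ge> 1 \<Longrightarrow> pole p \<in> unit_sphere p"
  by (simp add: unit_sphere_iff dot_pole) (simp add: pole_def)

text \<open>The reflection swapping \<theta> and the pole is an isometry, so coordinate 0 of the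
  image of x, its product with the pole, equals the product of x with \<theta>.\<close>

lemma obtain_reflection_to_pole:
  assumes "p \<ge> 1" "\<theta> \<in> unit_sphere p"
  obtains a where "\<And>x. reflect p a x 0 = dot p \<theta> x"
proof
  define a where "a = (\<lambda>i. \<theta> i - pole p i)"
  have "reflect p a \<theta> = pole p"
    unfolding a_def using assms pole_sphere[OF assms(1)]
        by (intro reflect_swap) (auto simp: unit_sphere_iff)
  then show "reflect p a x 0 = dot p \<theta> x" for x
    using dot_reflect[of p a \<theta> x] dot_pole[OF assms(1), of "reflect p a x"] by simp
qed

lemma nn_integral_uniform_sphere_dot:
  assumes "p \<ge> 2" "\<theta> \<in> unit_sphere p" and F[measurable]: "F \<in> borel_measurable borel"
  shows "(\<integral>\<^sup>+x. F (dot p \<theta> x) \<partial>uniform_sphere p) = (\<integral>\<^sup>+v. F (lat v) \<partial>slope_measure p)"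
proof -
  have p: "p \<ge> 1" using assms by simp
  obtain a where a: "\<And>x. reflect p a x 0 = dot p \<theta> x"
    using obtain_reflection_to_pole[OF p assms(2)] by blast
  have "(\<lambda>x. F (x 0)) \<in> borel_measurable (Pi\<^sub>M {..<p} (\<lambda>_. borel))"
    using assms by (intro measurable_compose[OF _ F] measurable_component_singleton) auto
  from nn_integral_uniform_sphere_reflect[OF this, of a]
  show ?thesis using nn_integral_uniform_sphere_slope[OF assms(1) F] by (simp add: a)
qed

text \<open>Rescaling \<open>w\<close> to the sphere reduces the integral to one coordinate. The
  zero vector is a separate case that does occur: the lemma is applied to x + y, which vanishes for
  antipodal points.\<close>

lemma nn_integral_uniform_sphere_exp_dot:
  assumes "p \<ge> 2"
  shows "(\<integral>\<^sup>+x. ennreal (exp (k * dot p w x)) \<partial>uniform_sphere p)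
      = ennreal (lat_mgf p (k * sqrt (dot p w w)))"
proof (cases "dot p w w = 0")
  case True
  then have zero: "dot p w x = 0" for x by (auto simp: dot_eq_0_iff) (simp add: dot_def)
  interpret prob_space "uniform_sphere p" using assms by (intro prob_space_uniform_sphere) auto
  show ?thesis using True assms by (simp add: zero emeasure_space_1 lat_mgf_0)
next
  case False
  define \<theta> where "\<theta> = radial_proj p w"
  have \<theta>: "\<theta> \<in> unit_sphere p" using False by (simp add: \<theta>_def radial_proj_in_sphere_iff)
  have w: "dot p w x = sqrt (dot p w w) * dot p \<theta> x" for x
    using False by (simp add: \<theta>_def dot_commute[of p "radial_proj p w"] dot_radial_proj
        dot_commute[of p x w])
  have "(\<integral>\<^sup>+x. ennreal (exp (k * dot p w x)) \<partial>uniform_sphere p)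
      = (\<integral>\<^sup>+x. ennreal (exp (k * sqrt (dot p w w) * dot p \<theta> x)) \<partial>uniform_sphere p)"
  proof (rule nn_integral_cong)
    fix x
    show "ennreal (exp (k * dot p w x)) = ennreal (exp (k * sqrt (dot p w w) * dot p \<theta> x))"
      by (simp only: w[of x] mult.assoc)
  qed
  also have "\<dots> = (\<integral>\<^sup>+v. ennreal (exp (k * sqrt (dot p w w) * lat v)) \<partial>slope_measure p)"
    by (rule nn_integral_uniform_sphere_dot[OF assms \<theta>]) measurable
  finally show ?thesis by (simp only: nn_integral_exp_lat[OF assms])
qed

lemma measurable_uniform_sphereD:
  "f \<in> M \<rightarrow>\<^sub>M uniform_sphere p \<Longrightarrow> f \<in> M \<rightarrow>\<^sub>M Pi\<^sub>M {..<p} (\<lambda>_. borel)"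
  using measurable_compose[OF _ measurable_uniform_sphereI[OF measurable_ident]] by simp

lemma measurable_dot_sphere[measurable (raw)]:
  assumes "f \<in> M \<rightarrow>\<^sub>M uniform_sphere p" "g \<in> M \<rightarrow>\<^sub>M uniform_sphere p"
  shows "(\<lambda>w. dot p (f w) (g w)) \<in> borel_measurable M"
  by (intro measurable_dot2 measurable_uniform_sphereD assms)

lemma measurable_dot_sphere_const[measurable]:
  "(\<lambda>x. dot p \<theta> x) \<in> borel_measurable (uniform_sphere p)"
  by (intro measurable_uniform_sphereI measurable_dot_const)

lemma dot_self_add_sphere:
  assumes "x \<in> unit_sphere p" "y \<in> unit_sphere p"
  shows "dot p (\<lambda>i. x i + y i) (\<lambda>i. x i + y i) = 2 + 2 * dot p x y"
proof -
  have "dot p (\<lambda>i. x i + y i) (\<lambda>i. x i + y i) = dot p x x + dot p y y + 2 * dot p x y"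
    by (simp add: dot_def algebra_simps sum.distrib sum_distrib_left)
  then show ?thesis using assms by (simp add: unit_sphere_iff)
qed

text \<open>By reflection invariance the left-hand side does not depend on \<open>\<theta>\<close>, so it may be averaged
  over \<open>\<theta>\<close>; the average of \<open>exp (k * dot p (x + y) \<theta>)\<close> is a function of the norm of \<open>x + y\<close>.\<close>

lemma nn_integral_pair_exp_dot:
  assumes "p \<ge> 2" "\<theta> \<in> unit_sphere p" and f[measurable]: "f \<in> borel_measurable borel"
  shows "(\<integral>\<^sup>+x. \<integral>\<^sup>+y. f (dot p x y) * ennreal (exp (k * (dot p \<theta> x
      + dot p \<theta> y))) \<partial>uniform_sphere p \<partial>uniform_sphere p)
    = (\<integral>\<^sup>+v. f (lat v) * ennreal (lat_mgf p (k * sqrt (2 + 2 * lat v))) \<partial>slope_measure p)"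
proof -
  let ?S = "uniform_sphere p"
  have p: "p \<ge> 1" using assms by simp
  interpret S: prob_space ?S using p by (rule prob_space_uniform_sphere)
  interpret SS: pair_sigma_finite ?S ?S ..
  note [measurable] = measurable_lat_mgf[OF assms(1)]
  define Q where "Q \<theta> = (\<integral>\<^sup>+x. \<integral>\<^sup>+y. f (dot p x y) * ennreal (exp (k * (dot p \<theta> x
      + dot p \<theta> y))) \<partial>?S \<partial>?S)" for \<theta>
  have Q_const: "Q \<theta> = Q (pole p)" if \<theta>: "\<theta> \<in> unit_sphere p" for \<theta>
  proof -
    define g where "g x y = f (dot p x y) * ennreal (exp (k * (x 0 + y 0)))" for x y :: "nat \<Rightarrow> real"
    obtain a where a: "\<And>x. reflect p a x 0 = dot p \<theta> x"
      using obtain_reflection_to_pole[OF p \<theta>] by blast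
    have comp: "(\<lambda>x. x 0) \<in> borel_measurable (Pi\<^sub>M {..<p} (\<lambda>_. borel))"
      using p by (intro measurable_component_singleton) auto
    \<comment> \<open>The reflection lemma asks for measurability on the whole product space, not
      merely on the sphere.\<close>
    have m1: "(\<lambda>y. g x y) \<in> borel_measurable (Pi\<^sub>M {..<p} (\<lambda>_. borel))" for x
      unfolding g_def
      by (intro borel_measurable_times_ennreal measurable_compose[OF _ f]
          measurable_compose[OF _ measurable_ennreal] measurable_compose[OF _
              borel_measurable_exp] borel_measurable_times
          borel_measurable_add borel_measurable_const comp measurable_dot_const)
    have "(\<lambda>(x, y). g x y) \<in> borel_measurable (Pi\<^sub>M {..<p} (\<lambda>_. borel) \<Otimes>\<^sub>M ?S)"
      unfolding g_def split_beta'
      by (intro borel_measurable_times_ennreal measurable_compose[OF _ f]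
          measurable_compose[OF _ measurable_ennreal] measurable_compose[OF _
              borel_measurable_exp] borel_measurable_times
          borel_measurable_add borel_measurable_const measurable_compose[OF _ comp] measurable_dot2
          measurable_fst measurable_uniform_sphereD[OF measurable_snd])
    from S.borel_measurable_nn_integral[OF this]
    have m2: "(\<lambda>x. \<integral>\<^sup>+y. g x y \<partial>?S) \<in> borel_measurable (Pi\<^sub>M {..<p} (\<lambda>_. borel))"
      by simp
    have "Q \<theta> = (\<integral>\<^sup>+x. \<integral>\<^sup>+y. g (reflect p a x) (reflect p a y) \<partial>?S \<partial>?S)"
      by (simp add: Q_def g_def a dot_reflect)
    also have "\<dots> = (\<integral>\<^sup>+x. \<integral>\<^sup>+y. g (reflect p a x) y \<partial>?S \<partial>?S)"
      by (intro nn_integral_cong nn_integral_uniform_sphere_reflect m1)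
    also have "\<dots> = (\<integral>\<^sup>+x. \<integral>\<^sup>+y. g x y \<partial>?S \<partial>?S)"
      by (rule nn_integral_uniform_sphere_reflect[OF m2])
    finally show ?thesis by (simp add: Q_def g_def dot_pole[OF p])
  qed
  have "Q \<theta> = (\<integral>\<^sup>+\<eta>. Q (pole p) \<partial>?S)"
    using Q_const[OF assms(2)] by (simp add: S.emeasure_space_1)
  also have "\<dots> = (\<integral>\<^sup>+\<eta>. Q \<eta> \<partial>?S)"
    by (intro nn_integral_cong) (simp add: Q_const space_uniform_sphere)
  \<comment> \<open>Fubini is applied twice to make the location \<eta> the innermost variable;
    there x + y is fixed.\<close>
  also have "\<dots> = (\<integral>\<^sup>+x. \<integral>\<^sup>+\<eta>. \<integral>\<^sup>+y. f (dot p x y) * ennreal (exp (k * (dot p \<eta> x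
      + dot p \<eta> y))) \<partial>?S \<partial>?S \<partial>?S)"
    unfolding Q_def by (rule SS.Fubini') measurable
  also have "\<dots> = (\<integral>\<^sup>+x. \<integral>\<^sup>+y. \<integral>\<^sup>+\<eta>. f (dot p x y) * ennreal (exp (k * (dot p \<eta> x
      + dot p \<eta> y))) \<partial>?S \<partial>?S \<partial>?S)"
    by (intro nn_integral_cong SS.Fubini') measurable
  also have "\<dots> = (\<integral>\<^sup>+x. \<integral>\<^sup>+y. f (dot p x y) * ennreal (lat_mgf p (k * sqrt (2
      + 2 * dot p x y))) \<partial>?S \<partial>?S)"
  proof (intro nn_integral_cong)
    fix x y assume xy: "x \<in> space ?S" "y \<in> space ?S"
    have "dot p \<eta> x + dot p \<eta> y = dot p (\<lambda>i. x i + y i) \<eta>" for \<eta>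
      by (simp add: dot_def algebra_simps sum.distrib)
    moreover have "(\<integral>\<^sup>+\<eta>. f (dot p x y) * ennreal (exp (k * dot p (\<lambda>i. x i + y i) \<eta>)) \<partial>?S)
        = f (dot p x y) * (\<integral>\<^sup>+\<eta>. ennreal (exp (k * dot p (\<lambda>i. x i + y i) \<eta>)) \<partial>?S)"
      by (rule nn_integral_cmult) measurable
    ultimately show "(\<integral>\<^sup>+\<eta>. f (dot p x y) * ennreal (exp (k * (dot p \<eta> x + dot p \<eta> y))) \<partial>?S)
      = f (dot p x y) * ennreal (lat_mgf p (k * sqrt (2 + 2 * dot p x y)))"
      using xy by (simp add: nn_integral_uniform_sphere_exp_dot[OF assms(1)] dot_self_add_sphere
          space_uniform_sphere)
  qed
  \<comment> \<open>Only \<open>dot p x y\<close> is left, so for each x the inner integral is a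
    slope integral independent of x, and the outer one has total mass 1.\<close>
  also have "\<dots> = (\<integral>\<^sup>+x. \<integral>\<^sup>+v. f (lat v) * ennreal (lat_mgf p (k * sqrt (2
      + 2 * lat v))) \<partial>slope_measure p \<partial>?S)"
    by (intro nn_integral_cong nn_integral_uniform_sphere_dot[OF assms(1),
        of _ "\<lambda>t. f t * ennreal (lat_mgf p (k * sqrt (2
            + 2 * t)))"]) (simp_all add: space_uniform_sphere)
  finally show ?thesis by (simp add: Q_def S.emeasure_space_1)
qed

lemma integral_uniform_sphere_exp_dot:
  assumes "p \<ge> 2" "\<theta> \<in> unit_sphere p"
  shows "(\<integral>y. exp (k * dot p y \<theta>) \<partial>uniform_sphere p) = lat_mgf p k"
proof -
  have comm: "dot p y \<theta> = dot p \<theta> y" for y by (rule dot_commute)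
  have "(\<integral>\<^sup>+y. ennreal (exp (k * dot p \<theta> y)) \<partial>uniform_sphere p) = ennreal (lat_mgf p k)"
    using nn_integral_uniform_sphere_exp_dot[OF assms(1), of k \<theta>] assms(2)
    by (simp add: unit_sphere_iff)
  then show ?thesis
    unfolding comm using lat_mgf_pos[OF assms(1), of k]
    by (subst integral_eq_nn_integral) (auto simp: less_imp_le)
qed

text \<open>The pair density is exp (k (\<theta> . x + \<theta> . y)) / c^2. The event and the
  constant are absorbed into the test function of \<open>nn_integral_pair_exp_dot\<close>, whose
  result no longer contains the location.\<close>

lemma prob_dot_fvml:
  assumes "p \<ge> 2" "\<theta> \<in> unit_sphere p"
  shows "\<P>((x, y) in fvml p k \<theta> \<Otimes>\<^sub>M fvml p k \<theta>. dot p x y \<le> t)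
    = (\<integral>v. indicator {..t} (lat v) * (lat_mgf p (k * sqrt (2
        + 2 * lat v)) / (lat_mgf p k)\<^sup>2) \<partial>slope_measure p)"
proof -
  let ?S = "uniform_sphere p"
  let ?E = "{(x, y) \<in> space (fvml p k \<theta> \<Otimes>\<^sub>M fvml p k \<theta>). dot p x y \<le> t}"
  interpret S: prob_space ?S using assms by (intro prob_space_uniform_sphere) simp
  interpret SS: pair_sigma_finite ?S ?S ..
  note [measurable] = measurable_lat_mgf[OF assms(1)]
  define c where "c = lat_mgf p k"
  have c: "c > 0" unfolding c_def by (rule lat_mgf_pos[OF assms(1)])
  define d where "d x = ennreal (exp (k * dot p \<theta> x) / c)" for x
  have d[measurable]: "d \<in> borel_measurable ?S" unfolding d_def[abs_def] by measurable
  have fvml: "fvml p k \<theta> = density ?S d"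
    unfolding fvml_def integral_uniform_sphere_exp_dot[OF assms] c_def d_def[abs_def]
    by (simp only: dot_commute[of p _ \<theta>])
  \<comment> \<open>Finite total mass supplies the sigma-finiteness required by
    \<open>pair_measure_density\<close>.\<close>
  have "(\<integral>\<^sup>+x. d x \<partial>?S) < \<infinity>"
  proof -
    have "(\<integral>\<^sup>+x. d x \<partial>?S) = (\<integral>\<^sup>+x. ennreal (1 / c) * ennreal (exp (k * dot p \<theta> x)) \<partial>?S)"
      using c by (simp add: d_def ennreal_mult[symmetric])
    also have "\<dots> = ennreal (1 / c) * ennreal (lat_mgf p (k * sqrt (dot p \<theta> \<theta>)))"
      by (subst nn_integral_cmult) (auto simp: nn_integral_uniform_sphere_exp_dot[OF assms(1)])
    also have "\<dots> < \<infinity>" by (simp add: ennreal_mult_less_top)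
    finally show ?thesis .
  qed
  then interpret D: finite_measure "density ?S d"
    by (intro finite_measureI) (simp add: emeasure_density cong: nn_integral_cong)
  have "{w \<in> space (?S \<Otimes>\<^sub>M ?S). dot p (fst w) (snd w) \<le> t} \<in> sets (?S \<Otimes>\<^sub>M ?S)"
    by measurable
  then have A: "?E \<in> sets (?S \<Otimes>\<^sub>M ?S)"
    by (simp add: fvml space_pair_measure split_beta' mem_Times_iff)
  have "emeasure (fvml p k \<theta> \<Otimes>\<^sub>M fvml p k \<theta>) ?E
    = (\<integral>\<^sup>+w. (case w of (x, y) \<Rightarrow> d x * d y) * indicator ?E w \<partial>(?S \<Otimes>\<^sub>M ?S))"
    unfolding fvml using A
    by (subst pair_measure_density[OF d d S.sigma_finite_measure_axioms
        D.sigma_finite_measure_axioms],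
        subst emeasure_density) (auto simp: fvml)
  also have "\<dots> = (\<integral>\<^sup>+w. (case w of (x, y) \<Rightarrow> d x * d y * indicator {..t} (dot p x y)) \<partial>(?S \<Otimes>\<^sub>M ?S))"
    by (intro nn_integral_cong) (auto simp: indicator_def fvml space_pair_measure)
  also have "\<dots> = (\<integral>\<^sup>+x. \<integral>\<^sup>+y. d x * d y * indicator {..t} (dot p x y) \<partial>?S \<partial>?S)"
  proof -
    have "(\<lambda>w. d (fst w) * d (snd w) * indicator {..t} (dot p (fst w)
        (snd w))) \<in> borel_measurable (?S \<Otimes>\<^sub>M ?S)"
      by measurable
    then show ?thesis by (subst S.nn_integral_fst[symmetric]) (simp_all add: split_beta')
  qed
  also have "\<dots> = (\<integral>\<^sup>+x. \<integral>\<^sup>+y. (ennreal (1 / c\<^sup>2) * indicator {..t} (dot p x y)) * ennreal (exp (k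
      * (dot p \<theta> x + dot p \<theta> y))) \<partial>?S \<partial>?S)"
  proof (intro nn_integral_cong)
    fix x y
    have "d x * d y = ennreal (1 / c\<^sup>2) * ennreal (exp (k * (dot p \<theta> x + dot p \<theta> y)))"
      using c by (simp add: d_def ennreal_mult[symmetric] exp_add[symmetric] power2_eq_square
          distrib_left)
    then show "d x * d y * indicator {..t} (dot p x y)
        = (ennreal (1 / c\<^sup>2) * indicator {..t} (dot p x y)) * ennreal (exp (k * (dot p \<theta> x
            + dot p \<theta> y)))"
      by (simp add: mult_ac)
  qed
  also have "\<dots> = (\<integral>\<^sup>+v. (ennreal (1 / c\<^sup>2) * indicator {..t} (lat v)) * ennreal (lat_mgf p (k
      * sqrt (2 + 2 * lat v))) \<partial>slope_measure p)"
    by (rule nn_integral_pair_exp_dot[OF assms, of "\<lambda>s. ennreal (1 / c\<^sup>2)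
        * indicator {..t} s"]) measurable
  also have "\<dots> = (\<integral>\<^sup>+v. ennreal (indicator {..t} (lat v) * (lat_mgf p (k * sqrt (2
      + 2 * lat v)) / c\<^sup>2)) \<partial>slope_measure p)"
    using c lat_mgf_pos[OF assms(1)]
    by (intro nn_integral_cong) (auto simp: indicator_def ennreal_mult[symmetric] less_imp_le)
  finally have *: "emeasure (fvml p k \<theta> \<Otimes>\<^sub>M fvml p k \<theta>) ?E = \<dots>" .
  show ?thesis
    unfolding measure_def * c_def[symmetric]
    using c lat_mgf_pos[OF assms(1)] by (subst integral_eq_nn_integral) (auto simp: less_imp_le)
qed

text \<open>With concentration 0 the FvML law is the uniform one, and \<open>lat_mgf p 0 = 1\<close>
  makes the likelihood factor trivial.\<close>

lemma prob_dot_uniform_sphere: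
  assumes "p \<ge> 2"
  shows "\<P>((x, y) in uniform_sphere p \<Otimes>\<^sub>M uniform_sphere p. dot p x y \<le> t)
    = (\<integral>v. indicator {..t} (lat v) \<partial>slope_measure p)"
proof -
  interpret U: prob_space "uniform_sphere p" using assms by (intro prob_space_uniform_sphere) simp
  have pole: "pole p \<in> unit_sphere p" using assms by (intro pole_sphere) simp
  have "fvml p 0 (pole p) = uniform_sphere p"
    by (simp add: fvml_def U.prob_space density_1)
  then show ?thesis using prob_dot_fvml[OF assms pole, of 0 t] assms by (simp add: lat_mgf_0)
qed

subsection \<open>The moment generating function of a coordinate\<close>

lemma LBINT_FTC_line:
  fixes f F :: "real \<Rightarrow> real"
  assumes "\<And>x. (F has_real_derivative f x) (at x)" "\<And>x. isCont f x" "integrable lborel f"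
    and "(F \<longlongrightarrow> A) at_bot" "(F \<longlongrightarrow> B) at_top"
  shows "(\<integral>x. f x \<partial>lborel) = B - A"
proof -
  have "(LBINT x=-\<infinity>..\<infinity>. f x) = B - A"
    by (rule interval_integral_FTC_integrable)
      (use assms in \<open>auto simp: has_real_derivative_iff_has_vector_derivative set_integrable_def
          ereal_tendsto_simps\<close>)
  then show ?thesis by (simp add: interval_lebesgue_integral_def set_lebesgue_integral_def)
qed

lemma LBINT_FTC_atMost:
  fixes f F :: "real \<Rightarrow> real"
  assumes "\<And>x. (F has_real_derivative f x) (at x)" "\<And>x. isCont f x" "integrable lborel f"
    and "(F \<longlongrightarrow> A) at_bot"
  shows "(\<integral>x. indicator {..b} x * f x \<partial>lborel) = F b - A"
proof -
  have "isCont F b" using assms(1) DERIV_isCont by blast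
  then have "(F \<longlongrightarrow> F b) (at_left b)" by (simp add: isCont_def filterlim_at_split)
  then have "(LBINT x=-\<infinity>..ereal b. f x) = F b - A"
    by (intro interval_integral_FTC_integrable)
      (use assms in \<open>auto simp: has_real_derivative_iff_has_vector_derivative set_integrable_def
        ereal_tendsto_simps integrable_mult_indicator[where 'b=real, simplified]\<close>)
  then have "(\<integral>x. indicator {..<b} x * f x \<partial>lborel) = F b - A"
    by (simp add: interval_lebesgue_integral_def set_lebesgue_integral_def)
  moreover have "f \<in> borel_measurable borel" using assms(3) by auto
  moreover have "AE x in lborel. indicator {..b} x * f x = indicator {..<b} x * f x"
    using AE_lborel_singleton[of b] by eventually_elim (auto simp: indicator_def)
  ultimately show ?thesis
    by (subst integral_cong_AE) auto
qed

abbreviation slope_norm :: "nat \<Rightarrow> real" where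
  "slope_norm p \<equiv> (\<integral>w. (1 + w\<^sup>2) powr (- real p / 2) \<partial>lborel)"

lemma integral_slope_measure:
  fixes f :: "real \<Rightarrow> real"
  assumes "p \<ge> 2" "f \<in> borel_measurable borel"
  shows "(\<integral>v. f v \<partial>slope_measure p) = (\<integral>v. (1
      + v\<^sup>2) powr (- real p / 2) * f v \<partial>lborel) / slope_norm p"
proof -
  have "(\<integral>v. f v \<partial>slope_measure p)
      = (\<integral>v. (1 + v\<^sup>2) powr (- real p / 2) / slope_norm p * f v \<partial>lborel)"
    unfolding slope_measure_def using assms slope_normalizer_pos[of p]
    by (subst integral_density) auto
  then show ?thesis by simp
qed

lemma one_minus_lat_sq: "1 - (lat v)\<^sup>2 = 1 / (1 + v\<^sup>2)"
  using one_plus_square_pos[of v] by (simp add: lat_def power_divide field_simps)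

lemma DERIV_lat: "(lat has_real_derivative (1 - (lat v)\<^sup>2) / sqrt (1 + v\<^sup>2)) (at v)"
proof -
  have "(lat has_real_derivative (sqrt (1 + v\<^sup>2) - v * (v / sqrt (1 + v\<^sup>2))) / (1 + v\<^sup>2)) (at v)"
    unfolding lat_def[abs_def] using one_plus_square_pos[of v]
    by (auto intro!: derivative_eq_intros simp: inverse_eq_divide)
  moreover have "(sqrt (1 + v\<^sup>2) - v * (v / sqrt (1 + v\<^sup>2))) / (1 + v\<^sup>2)
      = (1 - (lat v)\<^sup>2) / sqrt (1 + v\<^sup>2)"
  proof -
    have "sqrt (1 + v\<^sup>2) - v * (v / sqrt (1 + v\<^sup>2)) = ((1 + v\<^sup>2) - v\<^sup>2) / sqrt (1 + v\<^sup>2)"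
    proof -
      define s where "s = sqrt (1 + v\<^sup>2)"
      have s: "s > 0" "s * s = 1 + v\<^sup>2" using one_plus_square_pos[of v] by (simp_all add: s_def)
      have "s - v * (v / s) = (s * s - v\<^sup>2) / s"
        using s(1) by (simp add: field_simps power2_eq_square)
      then show ?thesis by (simp only: s(2)) (simp only: s_def)
    qed
    then show ?thesis by (simp add: one_minus_lat_sq)
  qed
  ultimately show ?thesis by simp
qed

text \<open>In the variable t = lat v the primitive is t^j (1 - t^2)^((p-1)/2), which up to a
  constant is t^j (1 - t^2) times the density of t. For j = 0 the term with \<open>j - 1\<close> is
  killed by its factor 0.\<close>

lemma DERIV_lat_primitive:
  "((\<lambda>v. lat v ^ j * (1 + v\<^sup>2) powr ((1 - real p) / 2)) has_real_derivative
    (1 + v\<^sup>2) powr (- real p / 2) * (real j * lat v ^ (j - 1) * (1 - (lat v)\<^sup>2) - (real p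
        - 1) * lat v ^ (j + 1))) (at v)"
proof -
  define w where "w = 1 + v\<^sup>2"
  have w: "w > 0" using one_plus_square_pos by (simp add: w_def)
  have d: "((\<lambda>v. (1 + v\<^sup>2) powr ((1 - real p) / 2)) has_real_derivative
      ((1 - real p) / 2) * w powr ((1 - real p) / 2 - 1) * (2 * v)) (at v)"
    using w by (auto intro!: derivative_eq_intros simp: w_def powr_diff)
  have lat_v: "v = lat v * w powr (1/2)"
    using w by (simp add: powr_half_sqrt lat_def w_def)
  have e1: "w powr ((1 - real p) / 2) / sqrt w = w powr (- real p / 2)"
    using w by (simp add: powr_half_sqrt[symmetric] powr_diff[symmetric] diff_divide_distrib)
  have e2: "w powr ((1 - real p) / 2 - 1) * w powr (1/2) = w powr (- real p / 2)"
    using w by (simp add: powr_add[symmetric] diff_divide_distrib)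
  have e3: "w powr ((1 - real p) / 2 - 1) * v = w powr (- real p / 2) * lat v"
  proof -
    have "w powr ((1 - real p) / 2 - 1) * v = w powr ((1 - real p) / 2
        - 1) * (lat v * w powr (1/2))"
      by (rule arg_cong[OF lat_v])
    also have "\<dots> = (w powr ((1 - real p) / 2 - 1) * w powr (1/2)) * lat v"
      by (simp only: mult_ac)
    finally show ?thesis by (simp only: e2)
  qed
  have eq: "real j * (lat v ^ (j - Suc 0) * ((1 - (lat v)\<^sup>2) / sqrt (1 + v\<^sup>2))) * w powr ((1
      - real p) / 2)
      + (1 - real p) / 2 * w powr ((1 - real p) / 2 - 1) * (2 * v) * lat v ^ j
    = real j * lat v ^ (j - 1) * (1 - (lat v)\<^sup>2) * (w powr ((1 - real p) / 2) / sqrt w)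
      - (real p - 1) * (w powr ((1 - real p) / 2 - 1) * v) * lat v ^ j"
    by (simp add: w_def field_simps)
  have "real j * (lat v ^ (j - Suc 0) * ((1 - (lat v)\<^sup>2) / sqrt (1 + v\<^sup>2))) * w powr ((1
      - real p) / 2)
      + (1 - real p) / 2 * w powr ((1 - real p) / 2 - 1) * (2 * v) * lat v ^ j
    = w powr (- real p / 2) * (real j * lat v ^ (j - 1) * (1 - (lat v)\<^sup>2) - (real p
        - 1) * lat v ^ (j + 1))"
    unfolding eq e1 e3 by (simp add: algebra_simps)
  from this[unfolded w_def] show ?thesis
    by (rule DERIV_cong[OF DERIV_mult[OF DERIV_power[OF DERIV_lat, of j] d[unfolded w_def]],
        OF trans[rotated]]) (simp only: mult_ac)
qed

lemma tendsto_lat_primitive: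
  assumes "p \<ge> 2"
  shows "((\<lambda>v. lat v ^ j * (1 + v\<^sup>2) powr ((1 - real p) / 2)) \<longlongrightarrow> 0) at_top"
    and "((\<lambda>v. lat v ^ j * (1 + v\<^sup>2) powr ((1 - real p) / 2)) \<longlongrightarrow> 0) at_bot"
proof -
  have "norm (lat v ^ j * (1 + v\<^sup>2) powr ((1 - real p) / 2)) \<le> (1 + v\<^sup>2) powr (- 1 / 2)" for v
  proof -
    have "norm (lat v ^ j * (1 + v\<^sup>2) powr ((1 - real p) / 2)) \<le> 1 * (1 + v\<^sup>2) powr (- 1 / 2)"
      unfolding norm_mult
      using assms abs_lat_less_1[of v]
      by (intro mult_mono) (auto simp: power_abs intro!: power_le_one powr_mono)
    then show ?thesis by simp
  qed
  then have *: "\<forall>\<^sub>F v in F. norm (lat v ^ j * (1 + v\<^sup>2) powr ((1 - real p) / 2))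
      \<le> (1 + v\<^sup>2) powr (- 1 / 2)" for F
    by (intro always_eventually) auto
  have "((\<lambda>v::real. (1 + v\<^sup>2) powr (- 1 / 2)) \<longlongrightarrow> 0) at_top" by real_asymp
  from Lim_null_comparison[OF * this]
  show "((\<lambda>v. lat v ^ j * (1 + v\<^sup>2) powr ((1 - real p) / 2)) \<longlongrightarrow> 0) at_top" .
  have "((\<lambda>v::real. (1 + v\<^sup>2) powr (- 1 / 2)) \<longlongrightarrow> 0) at_bot" by real_asymp
  from Lim_null_comparison[OF * this]
  show "((\<lambda>v. lat v ^ j * (1 + v\<^sup>2) powr ((1 - real p) / 2)) \<longlongrightarrow> 0) at_bot" .
qed

lemma isCont_lat: "isCont lat v"
  using DERIV_lat DERIV_isCont by blast

lemma abs_power_le_1: "\<bar>x\<bar> \<le> 1 \<Longrightarrow> \<bar>x ^ n\<bar> \<le> (1::real)"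
  by (simp add: power_abs power_le_one)

lemma integrable_slope_density_mult:
  fixes f :: "real \<Rightarrow> real"
  assumes "p \<ge> 2" and [measurable]: "f \<in> borel_measurable borel"
    and f: "\<And>x. \<bar>x\<bar> \<le> 1 \<Longrightarrow> \<bar>f x\<bar> \<le> B"
  shows "integrable lborel (\<lambda>v. (1 + v\<^sup>2) powr (- real p / 2) * f (lat v))"
proof (rule Bochner_Integration.integrable_bound)
  show "integrable lborel (\<lambda>v. (1 + v\<^sup>2) powr (- real p / 2) * B)"
    using integrable_slope_density[OF assms(1)] by simp
  have "\<bar>f (lat v)\<bar> \<le> \<bar>B\<bar>" for v
    using f[of "lat v"] abs_lat_less_1[of v] by simp
  then show "AE v in lborel. norm ((1 + v\<^sup>2) powr (- real p / 2) * f (lat v))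
      \<le> norm ((1 + v\<^sup>2) powr (- real p / 2) * B)"
    by (auto simp: abs_mult intro!: mult_left_mono)
qed measurable

lemma lat_primitive_bound:
  assumes "\<bar>x\<bar> \<le> (1::real)"
  shows "\<bar>real j * x ^ (j - 1) * (1 - x\<^sup>2) - (real p - 1) * x ^ (j + 1)\<bar>
      \<le> real j * 2 + \<bar>real p - 1\<bar>"
proof -
  have "\<bar>1 - x\<^sup>2\<bar> \<le> 2"
    using abs_power_le_1[OF assms, of 2] zero_le_power2[of x] by (simp only: abs_le_iff) linarith
  then have "\<bar>real j * x ^ (j - 1) * (1 - x\<^sup>2)\<bar> \<le> real j * 1 * 2"
    unfolding abs_mult using abs_power_le_1[OF assms] by (intro mult_mono) auto
  moreover have "\<bar>(real p - 1) * x ^ (j + 1)\<bar> \<le> \<bar>real p - 1\<bar> * 1"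
    unfolding abs_mult[of "real p - 1"] using abs_power_le_1[OF assms, of "j + 1"]
    by (intro mult_left_mono) auto
  ultimately show ?thesis
    by (intro order_trans[OF abs_triangle_ineq4] add_mono) simp_all
qed

text \<open>The primitive vanishes at both ends of the line, so its derivative integrates to 0. This
  is Stein's identity for the law of a coordinate.\<close>

lemma integral_lat_stein:
  assumes "p \<ge> 2"
  shows "(\<integral>v. real j * lat v ^ (j - 1) * (1 - (lat v)\<^sup>2) - (real p - 1) * lat v ^ (j
      + 1) \<partial>slope_measure p) = 0"
proof -
  have "(\<integral>v. (1 + v\<^sup>2) powr (- real p / 2) * (real j * lat v ^ (j - 1) * (1 - (lat v)\<^sup>2)
      - (real p - 1) * lat v ^ (j + 1)) \<partial>lborel) = 0 - 0"
  proof (rule LBINT_FTC_line[OF DERIV_lat_primitive _ _ tendsto_lat_primitive(2,1)[OF assms]])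
    show "isCont (\<lambda>v. (1 + v\<^sup>2) powr (- real p / 2) * (real j * lat v ^ (j - 1) * (1 - (lat v)\<^sup>2)
      - (real p - 1) * lat v ^ (j + 1))) x" for x
      using one_plus_square_pos[of x] by (auto intro!: continuous_intros isCont_lat)
    show "integrable lborel (\<lambda>v. (1 + v\<^sup>2) powr (- real p / 2) * (real j * lat v ^ (j - 1) * (1
        - (lat v)\<^sup>2)
      - (real p - 1) * lat v ^ (j + 1)))"
      by (rule integrable_slope_density_mult[OF assms _ lat_primitive_bound]) measurable
  qed
  then show ?thesis
    by (subst integral_slope_measure[OF assms]) auto
qed

lemma integrable_lat_power:
  assumes "p \<ge> 2"
  shows "integrable (slope_measure p) (\<lambda>v. lat v ^ j)"
  by (rule integrable_slope_measure_lat[OF assms _ abs_power_le_1]) auto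

text \<open>Stein's identity at \<open>j + 1\<close>, with the two multiples of
  \<open>lat v ^ (j + 2)\<close> collected: (j + 1) + (p - 1) = p + j.\<close>

lemma lat_moment_Suc_Suc:
  assumes "p \<ge> 2"
  shows "(\<integral>v. lat v ^ (j + 2) \<partial>slope_measure p)
      = (real j + 1) / (real p + real j) * (\<integral>v. lat v ^ j \<partial>slope_measure p)"
proof -
  note int = integrable_lat_power[OF assms]
  have "0 = (\<integral>v. real (j + 1) * lat v ^ j * (1 - (lat v)\<^sup>2) - (real p - 1) * lat v ^ (j
      + 2) \<partial>slope_measure p)"
    using integral_lat_stein[OF assms, of "j + 1"] by simp
  also have "\<dots> = (\<integral>v. (real j + 1) * lat v ^ j - (real p + real j) * lat v ^ (j
      + 2) \<partial>slope_measure p)"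
    by (intro Bochner_Integration.integral_cong) (simp_all add: algebra_simps power2_eq_square)
  also have "\<dots> = (real j + 1) * (\<integral>v. lat v ^ j \<partial>slope_measure p)
      - (real p + real j) * (\<integral>v. lat v ^ (j + 2) \<partial>slope_measure p)"
    using int[of j] int[of "j + 2"] by simp
  finally show ?thesis using assms by (simp add: field_simps)
qed

lemma lat_moment_odd:
  assumes "p \<ge> 2"
  shows "(\<integral>v. lat v ^ (2 * j + 1) \<partial>slope_measure p) = 0"
proof (induction j)
  case 0
  \<comment> \<open>At j = 0 Stein's identity reduces to -(p - 1) E T = 0.\<close>
  then show ?case using integral_lat_stein[OF assms, of 0] assms by simp
next
  case (Suc j)
  then show ?case using lat_moment_Suc_Suc[OF assms, of "2 * j + 1"] by (simp add: add.commute)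
qed

text \<open>The form isolates the Poisson weights l^j / fact j with l = k^2 / (2p): each use of the
  moment recursion contributes l / (j + 1) and one correction factor p / (p + 2j).\<close>

lemma lat_moment_even:
  assumes "p \<ge> 2"
  shows "k ^ (2 * j) * (\<integral>v. lat v ^ (2 * j) \<partial>slope_measure p) / fact (2 * j)
    = (k\<^sup>2 / (2 * real p)) ^ j / fact j * (\<Prod>i<j. real p / (real p + 2 * real i))"
proof (induction j)
  case 0
  then show ?case using assms by simp
next
  case (Suc j)
  define M where "M = (\<integral>v. lat v ^ (2 * j) \<partial>slope_measure p)"
  have p: "real p > 0" using assms by simp
  have "k ^ (2 * Suc j) * (\<integral>v. lat v ^ (2 * Suc j) \<partial>slope_measure p) / fact (2 * Suc j)
    = k ^ (2 * j) * k\<^sup>2 * ((2 * real j + 1) / (real p + 2 * real j) * M) / ((2 * real j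
        + 2) * ((2 * real j + 1) * fact (2 * j)))"
    using lat_moment_Suc_Suc[OF assms, of "2 * j"]
        by (simp add: M_def power2_eq_square algebra_simps)
  also have "\<dots> = (k ^ (2 * j) * M / fact (2 * j)) * (k\<^sup>2 / ((real p + 2 * real j) * (2 * real j
      + 2)))"
    using p by (simp add: divide_simps)
  also have "k ^ (2 * j) * M / fact (2 * j)
      = (k\<^sup>2 / (2 * real p)) ^ j / fact j * (\<Prod>i<j. real p / (real p + 2 * real i))"
    using Suc by (simp add: M_def)
  also have "k\<^sup>2 / ((real p + 2 * real j) * (2 * real j + 2))
      = (k\<^sup>2 / (2 * real p)) * (real p / (real p + 2 * real j)) / (real j + 1)"
    using p by (simp add: divide_simps) (simp add: algebra_simps)
  finally show ?case by (simp add: field_simps)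
qed

lemma exp_sums: "(\<lambda>j. x ^ j / fact j) sums exp (x::real)"
  using exp_converges[of x] by (simp only: divide_inverse_commute real_scaleR_def)

text \<open>Since |lat v| < 1, the majorant |k|^j / fact j justifies integrating the exponential
  series termwise. The odd terms vanish.\<close>

lemma lat_mgf_sums:
  assumes "p \<ge> 2"
  shows "(\<lambda>j. (k\<^sup>2 / (2 * real p)) ^ j / fact j * (\<Prod>i<j. real p / (real p
      + 2 * real i))) sums lat_mgf p k"
proof -
  let ?f = "\<lambda>j v. (k * lat v) ^ j / fact j"
  let ?M = "slope_measure p"
  interpret prob_space ?M using assms by (rule prob_space_slope_measure)
  have int: "integrable ?M (?f j)" for j
    using integrable_lat_power[OF assms, of j] by (simp add: power_mult_distrib)
  have bound: "norm (?f j v) \<le> \<bar>k\<bar> ^ j / fact j" for j v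
  proof -
    have "\<bar>k\<bar> ^ j * \<bar>lat v ^ j\<bar> \<le> \<bar>k\<bar> ^ j * 1"
      using abs_lat_less_1[of v] by (intro mult_left_mono abs_power_le_1) auto
    then show ?thesis by (simp add: abs_mult power_mult_distrib power_abs divide_right_mono)
  qed
  have summ: "summable (\<lambda>j. \<bar>k\<bar> ^ j / fact j)"
    using exp_sums sums_summable by blast
  have "AE v in ?M. summable (\<lambda>j. norm (?f j v))"
    using summable_comparison_test'[OF summ, of 0 "\<lambda>j. norm (?f j _)"] bound by auto
  moreover have "summable (\<lambda>j. \<integral>v. norm (?f j v) \<partial>?M)"
  proof (rule summable_comparison_test'[OF summ, of 0])
    fix j
    have "(\<integral>v. norm (?f j v) \<partial>?M) \<le> (\<integral>v. \<bar>k\<bar> ^ j / fact j \<partial>?M)"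
      by (intro integral_mono integrable_norm[OF int] integrable_const bound)
    then show "norm (\<integral>v. norm (?f j v) \<partial>?M) \<le> \<bar>k\<bar> ^ j / fact j"
      using assms by simp
  qed
  ultimately have "(\<lambda>j. \<integral>v. ?f j v \<partial>?M) sums (\<integral>v. (\<Sum>j. ?f j v) \<partial>?M)"
    using int by (intro sums_integral)
  moreover have "(\<Sum>j. ?f j v) = exp (k * lat v)" for v
    using exp_sums sums_unique by metis
  ultimately have "(\<lambda>j. \<integral>v. ?f j v \<partial>?M) sums lat_mgf p k"
    by (simp add: lat_mgf_def)
  then have all: "(\<lambda>j. k ^ j * (\<integral>v. lat v ^ j \<partial>?M) / fact j) sums lat_mgf p k"
    by (simp add: power_mult_distrib)
  have "(\<lambda>j. k ^ (2 * j) * (\<integral>v. lat v ^ (2 * j) \<partial>?M) / fact (2 * j)) sums lat_mgf p k"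
  proof (subst sums_mono_reindex[of "\<lambda>j. 2 * j" "\<lambda>j. k ^ j * (\<integral>v. lat v ^ j \<partial>?M) / fact j"])
    show "strict_mono (\<lambda>j::nat. 2 * j)" by (simp add: strict_mono_def)
    fix n :: nat assume "n \<notin> range (\<lambda>j. 2 * j)"
    then have "odd n" by (auto elim: evenE)
    then show "k ^ n * (\<integral>v. lat v ^ n \<partial>?M) / fact n = 0"
      using lat_moment_odd[OF assms] by (auto elim!: oddE)
  qed (rule all)
  then show ?thesis unfolding lat_moment_even[OF assms] .
qed

text \<open>All correction factors are at most 1. The result is a sub-Gaussian bound: for k = c sqrt
  p the right side is exp (c^2 / 2), whatever p is.\<close>

lemma lat_mgf_le:
  assumes "p \<ge> 2"
  shows "lat_mgf p k \<le> exp (k\<^sup>2 / (2 * real p))"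
proof (rule sums_le[OF _ lat_mgf_sums[OF assms]])
  show "(\<lambda>j. (k\<^sup>2 / (2 * real p)) ^ j / fact j) sums exp (k\<^sup>2 / (2 * real p))"
    by (rule exp_sums)
  fix j :: nat
  have "(\<Prod>i<j. real p / (real p + 2 * real i)) \<le> 1"
    using assms by (intro prod_le_1) auto
  then show "(k\<^sup>2 / (2 * real p)) ^ j / fact j * (\<Prod>i<j. real p / (real p + 2 * real i))
      \<le> (k\<^sup>2 / (2 * real p)) ^ j / fact j"
    by (intro mult_left_le) auto
qed

text \<open>Jensen's inequality for the Poisson weights \<open>l ^ j / fact j\<close>, whose second factorial
  moment is \<open>l\<^sup>2\<close>; it is used in the form \<open>exp (- b) \<ge> exp (- B) * (1 - b + B)\<close>.\<close>

lemma lat_mgf_ge: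
  assumes "p \<ge> 2"
  shows "exp (k\<^sup>2 / (2 * real p) - k ^ 4 / (4 * real p ^ 3)) \<le> lat_mgf p k"
proof -
  define l where "l = k\<^sup>2 / (2 * real p)"
  \<comment> \<open>\<open>B\<close> is the mean of j (j - 1) / p under the Poisson weights with
    parameter \<open>l\<close>. Linearizing the exponential at this mean leaves exactly exp (- B)
    after summation.\<close>
  define B where "B = l\<^sup>2 / real p"
  have p: "real p > 0" using assms by simp
  have l: "l \<ge> 0" by (simp add: l_def)
  define f where "f j = l ^ j / fact j * (real j * (real j - 1))" for j
  \<comment> \<open>The terms j = 0 and j = 1 vanish, and the shift by 2 cancels j (j - 1) against
    the factorial.\<close>
  have "(\<lambda>j. f (j + 2)) sums (l\<^sup>2 * exp l)"
  proof -
    have "f (j + 2) = l\<^sup>2 * (l ^ j / fact j)" for j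
      unfolding f_def by (simp add: power2_eq_square divide_simps del: of_nat_Suc)
    then show ?thesis using sums_mult[OF exp_sums[of l], of "l\<^sup>2"] by (simp only:)
  qed
  then have "f sums (l\<^sup>2 * exp l + (\<Sum>i<2. f i))"
    by (rule sums_iff_shift[THEN iffD1])
  moreover have "(\<Sum>i<2. f i) = 0" by (simp add: f_def numeral_2_eq_2)
  ultimately have fact_moment: "(\<lambda>j. l ^ j / fact j * (real j * (real j - 1))) sums (l\<^sup>2 * exp l)"
    by (simp add: f_def[abs_def])
  \<comment> \<open>Each factor is at least exp (- 2i / p), and the sum of 2i over i < j is j (j -
    1).\<close>
  have prod_ge: "exp (- (real j * (real j - 1) / real p))
      \<le> (\<Prod>i<j. real p / (real p + 2 * real i))" for j
  proof (induction j)
    case (Suc j)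
    have "exp (- (2 * real j / real p)) \<le> real p / (real p + 2 * real j)"
    proof -
      have "(real p + 2 * real j) / real p \<le> exp (2 * real j / real p)"
        using exp_ge_add_one_self[of "2 * real j / real p"] p by (simp add: add_divide_distrib)
      then have "inverse (exp (2 * real j / real p)) \<le> inverse ((real p + 2 * real j) / real p)"
        using p by (intro le_imp_inverse_le) auto
      then show ?thesis by (simp add: exp_minus)
    qed
    then have "exp (- (real j * (real j - 1) / real p)) * exp (- (2 * real j / real p))
        \<le> (\<Prod>i<j. real p / (real p + 2 * real i)) * (real p / (real p + 2 * real j))"
      using Suc by (intro mult_mono) (auto intro!: prod_nonneg)
    moreover have "exp (- (real j * (real j - 1) / real p)) * exp (- (2 * real j / real p))
        = exp (- (real (Suc j) * (real (Suc j) - 1) / real p))"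
      unfolding exp_add[symmetric] using p by (simp add: field_simps)
    ultimately show ?case by simp
  qed simp
  have "(\<lambda>j. exp (- B) * ((1 + B) * (l ^ j / fact j) - 1 / real p * (l ^ j / fact j * (real j
      * (real j - 1)))))
      sums (exp (- B) * ((1 + B) * exp l - 1 / real p * (l\<^sup>2 * exp l)))"
    by (intro sums_mult sums_diff exp_sums fact_moment)
  also have "exp (- B) * ((1 + B) * exp l - 1 / real p * (l\<^sup>2 * exp l)) = exp (l - B)"
    by (simp add: B_def algebra_simps exp_diff exp_minus divide_inverse)
  finally have low: "(\<lambda>j. exp (- B) * ((1 + B) * (l ^ j / fact j)
      - 1 / real p * (l ^ j / fact j * (real j * (real j - 1)))))
      sums exp (l - B)" .
  have le: "exp (- B) * ((1 + B) * (l ^ j / fact j) - 1 / real p * (l ^ j / fact j * (real j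
      * (real j - 1))))
        \<le> l ^ j / fact j * (\<Prod>i<j. real p / (real p + 2 * real i))" for j
  proof -
    define b where "b = real j * (real j - 1) / real p"
    have "1 + B - b \<le> exp (B - b)"
      using exp_ge_add_one_self[of "B - b"] by linarith
    then have "exp (- B) * (1 + B - b) \<le> exp (- B) * exp (B - b)"
      by (intro mult_left_mono) auto
    also have "\<dots> = exp (- b)" by (simp add: exp_add[symmetric])
    also have "\<dots> \<le> (\<Prod>i<j. real p / (real p + 2 * real i))"
      using prod_ge[of j] by (simp add: b_def)
    finally have "l ^ j / fact j * (exp (- B) * (1 + B - b))
        \<le> l ^ j / fact j * (\<Prod>i<j. real p / (real p + 2 * real i))"
      using l by (intro mult_left_mono) auto
    moreover have "exp (- B) * ((1 + B) * (l ^ j / fact j)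
        - 1 / real p * (l ^ j / fact j * (real j * (real j - 1))))
        = l ^ j / fact j * (exp (- B) * (1 + B - b))"
      unfolding b_def by (simp add: algebra_simps diff_divide_distrib add_divide_distrib)
    ultimately show ?thesis by simp
  qed
  have "exp (l - B) \<le> lat_mgf p k"
    by (rule sums_le[OF le low]) (use lat_mgf_sums[OF assms] in \<open>simp add: l_def\<close>)
  also have "l - B = k\<^sup>2 / (2 * real p) - k ^ 4 / (4 * real p ^ 3)"
    using p by (simp add: B_def l_def power_divide field_simps) (simp add: eval_nat_numeral)
  finally show ?thesis .
qed

subsection \<open>Asymptotics\<close>

definition dot_likelihood :: "nat \<Rightarrow> real \<Rightarrow> real \<Rightarrow> real" where
  "dot_likelihood p k t = lat_mgf p (k * sqrt (2 + 2 * t)) / (lat_mgf p k)\<^sup>2"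

text \<open>With c = k^4 / p^3, the numerator loses at most (2 + 2t)^2 c / 4 \<le> 4c, since 2 + 2t
  \<le> 4, and the squared denominator at most c / 2. The constant 4 covers both losses.\<close>

lemma dot_likelihood_bounds:
  assumes "p \<ge> 2" "\<bar>t\<bar> \<le> 1"
  shows "exp (k\<^sup>2 * t / real p - 4 * k ^ 4 / real p ^ 3) \<le> dot_likelihood p k t"
    and "dot_likelihood p k t \<le> exp (k\<^sup>2 * t / real p + 4 * k ^ 4 / real p ^ 3)"
proof -
  define c where "c = k ^ 4 / real p ^ 3"
  have c: "c \<ge> 0" by (simp add: c_def)
  have p: "real p > 0" using assms by simp
  have sq: "(k * sqrt (2 + 2 * t))\<^sup>2 = k\<^sup>2 * (2 + 2 * t)"
    using assms(2) by (simp add: power_mult_distrib abs_le_iff)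
  have "(k * sqrt (2 + 2 * t)) ^ 4 = ((k * sqrt (2 + 2 * t))\<^sup>2)\<^sup>2" by simp
  also have "\<dots> = k ^ 4 * (2 + 2 * t)\<^sup>2"
    unfolding sq by (simp add: power_mult_distrib)
  finally have four: "(k * sqrt (2 + 2 * t)) ^ 4 = k ^ 4 * (2 + 2 * t)\<^sup>2" .
  have den_pos: "(lat_mgf p k)\<^sup>2 > 0"
    using lat_mgf_pos[OF assms(1), of k] by simp
  have "lat_mgf p k ^ 2 \<le> exp (k\<^sup>2 / (2 * real p)) ^ 2"
    using lat_mgf_le[OF assms(1), of k] lat_mgf_pos[OF assms(1), of k] by (intro power_mono) auto
  also have "\<dots> = exp (k\<^sup>2 / real p)"
    by (simp add: exp_double[symmetric])
  finally have den_le: "(lat_mgf p k)\<^sup>2 \<le> exp (k\<^sup>2 / real p)" .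
  have "exp (k\<^sup>2 / real p - c / 2) = exp (k\<^sup>2 / (2 * real p) - c / 4) ^ 2"
    by (simp add: exp_double[symmetric] algebra_simps)
  also have "\<dots> \<le> lat_mgf p k ^ 2"
    using lat_mgf_ge[OF assms(1), of k] by (intro power_mono) (auto simp: c_def mult.commute)
  finally have den_ge: "exp (k\<^sup>2 / real p - c / 2) \<le> (lat_mgf p k)\<^sup>2" .
  have "(2 + 2 * t)\<^sup>2 \<le> 4\<^sup>2" using assms(2) by (intro power_mono) (auto simp: abs_le_iff)
  then have "c * ((2 + 2 * t)\<^sup>2 / 4) \<le> c * 4" using c by (intro mult_left_mono) auto
  then have "exp (k\<^sup>2 / real p + k\<^sup>2 * t / real p - 4 * c)
      \<le> exp ((k * sqrt (2 + 2 * t))\<^sup>2 / (2 * real p) - (k * sqrt (2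
          + 2 * t)) ^ 4 / (4 * real p ^ 3))"
    unfolding sq four by (simp add: c_def algebra_simps add_divide_distrib)
  also have "\<dots> \<le> lat_mgf p (k * sqrt (2 + 2 * t))"
    by (rule lat_mgf_ge[OF assms(1)])
  finally have num_ge: "exp (k\<^sup>2 / real p + k\<^sup>2 * t / real p - 4 * c)
      \<le> lat_mgf p (k * sqrt (2 + 2 * t))" .
  have "lat_mgf p (k * sqrt (2 + 2 * t)) \<le> exp ((k * sqrt (2 + 2 * t))\<^sup>2 / (2 * real p))"
    by (rule lat_mgf_le[OF assms(1)])
  also have "(k * sqrt (2 + 2 * t))\<^sup>2 / (2 * real p) = k\<^sup>2 / real p + k\<^sup>2 * t / real p"
    unfolding sq using p by (simp add: field_simps)
  finally have num_le: "lat_mgf p (k * sqrt (2 + 2 * t)) \<le> exp (k\<^sup>2 / real p + k\<^sup>2 * t / real p)" .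
  have "exp (k\<^sup>2 * t / real p - 4 * c) = exp (k\<^sup>2 / real p + k\<^sup>2 * t / real p
      - 4 * c) / exp (k\<^sup>2 / real p)"
    by (simp add: exp_diff[symmetric])
  also have "\<dots> \<le> dot_likelihood p k t"
    unfolding dot_likelihood_def using num_ge den_le den_pos
        by (intro frac_le) (auto intro: less_imp_le lat_mgf_pos[OF assms(1)])
  finally show "exp (k\<^sup>2 * t / real p - 4 * k ^ 4 / real p ^ 3) \<le> dot_likelihood p k t"
    by (simp add: c_def)
  have "dot_likelihood p k t \<le> exp (k\<^sup>2 / real p + k\<^sup>2 * t / real p) / exp (k\<^sup>2 / real p - c / 2)"
    unfolding dot_likelihood_def using num_le den_ge by (intro frac_le) auto
  also have "\<dots> = exp (k\<^sup>2 * t / real p + c / 2)"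
    by (simp add: exp_diff[symmetric])
  also have "\<dots> \<le> exp (k\<^sup>2 * t / real p + 4 * c)"
    using c by simp
  finally show "dot_likelihood p k t \<le> exp (k\<^sup>2 * t / real p + 4 * k ^ 4 / real p ^ 3)"
    by (simp add: c_def)
qed

text \<open>Multiplying exp (- y) \<ge> 1 - y by exp y bounds the nonnegative difference by y (exp y
  - 1), which is then estimated separately for the two signs of y.\<close>

lemma abs_exp_minus_one_minus_le: "\<bar>exp y - 1 - y\<bar> \<le> y\<^sup>2 * exp \<bar>y::real\<bar>"
proof -
  have "exp y * (1 - y) \<le> exp y * exp (- y)"
    using exp_ge_add_one_self[of "- y"] by (intro mult_left_mono) auto
  then have up: "exp y - 1 - y \<le> y * (exp y - 1)"
    by (simp add: exp_minus algebra_simps)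
  have "y * (exp y - 1) \<le> y\<^sup>2 * exp \<bar>y\<bar>"
  proof (cases "y \<ge> 0")
    case True
    have "exp y - 1 \<le> y * exp y" using up by (simp add: algebra_simps)
    then have "y * (exp y - 1) \<le> y * (y * exp y)" using True by (intro mult_left_mono) auto
    then show ?thesis using True by (simp add: power2_eq_square mult.assoc)
  next
    case False
    have "1 - exp y \<le> - y" using exp_ge_add_one_self[of y] by linarith
    then have "(- y) * (1 - exp y) \<le> (- y) * (- y)"
      using False by (intro mult_left_mono) auto
    then have "y * (exp y - 1) \<le> y\<^sup>2 * 1" by (simp add: power2_eq_square algebra_simps)
    also have "\<dots> \<le> y\<^sup>2 * exp \<bar>y\<bar>" by (intro mult_left_mono) auto
    finally show ?thesis .
  qed
  then show ?thesis using up exp_ge_add_one_self[of y] by linarith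
qed

text \<open>The distance splits into a multiplicative error around exp y and the Taylor remainder of
  exp y. The inequality 1 - exp (- d) \<le> exp d - 1 lets one term serve both sides.\<close>

lemma abs_minus_one_minus_le:
  fixes h y d :: real
  assumes "exp (y - d) \<le> h" "h \<le> exp (y + d)" "d \<ge> 0"
  shows "\<bar>h - 1 - y\<bar> \<le> (exp d - 1) * exp y + y\<^sup>2 * exp \<bar>y\<bar>"
proof -
  have "1 - exp (- d) \<le> exp d - 1"
    using exp_ge_add_one_self[of d] exp_ge_add_one_self[of "- d"] by linarith
  then have "(1 - exp (- d)) * exp y \<le> (exp d - 1) * exp y" by (intro mult_right_mono) auto
  moreover have "exp (y - d) = exp (- d) * exp y" "exp (y + d) = exp d * exp y"
    by (simp_all add: exp_add[symmetric])
  ultimately have "\<bar>h - exp y\<bar> \<le> (exp d - 1) * exp y"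
    using assms by (simp add: abs_le_iff algebra_simps)
  then show ?thesis using abs_exp_minus_one_minus_le[of y] by linarith
qed

text \<open>Trades the quadratic factor for pure exponentials, so that the remainder can be
  integrated by the moment generating function alone. The 2 comes from s^2 \<le> 2 exp |s|, and a
  \<le> 1 bounds the other factor by exp |s|.\<close>

lemma sq_mult_exp_abs_le:
  fixes s a :: real
  assumes "0 \<le> a" "a \<le> 1"
  shows "s\<^sup>2 * exp (a * \<bar>s\<bar>) \<le> 2 * (exp (2 * s) + exp (- 2 * s))"
proof -
  have "s\<^sup>2 \<le> 2 * exp \<bar>s\<bar>"
    using exp_lower_Taylor_quadratic[of "\<bar>s\<bar>"] by simp
  moreover have "exp (a * \<bar>s\<bar>) \<le> exp \<bar>s\<bar>"
    using assms by (simp add: mult_left_le_one_le)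
  ultimately have "s\<^sup>2 * exp (a * \<bar>s\<bar>) \<le> 2 * exp \<bar>s\<bar> * exp \<bar>s\<bar>"
    by (intro mult_mono) auto
  also have "\<dots> = 2 * exp (2 * \<bar>s\<bar>)" by (simp add: exp_add[symmetric])
  also have "exp (2 * \<bar>s\<bar>) \<le> exp (2 * s) + exp (- 2 * s)"
    by (cases "s \<ge> 0") auto
  finally show ?thesis by simp
qed

text \<open>With d = 4 \<tau>^4 / n^2 and a = \<tau>^2 / n, the summands are n (exp d - 1) exp (a^2
  / 2) and n a^2 * 2 * (exp 2 + exp 2); both are of order 1/n.\<close>

definition likelihood_error :: "real \<Rightarrow> nat \<Rightarrow> real" where
  "likelihood_error \<tau> n = real n * ((exp (4 * \<tau> ^ 4 / (real n)\<^sup>2)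
      - 1) * exp (\<tau> ^ 4 / (2 * (real n)\<^sup>2)))
    + 4 * exp 2 * \<tau> ^ 4 / real n"

lemma likelihood_error_tendsto:
  assumes "\<tau> > 0"
  shows "likelihood_error \<tau> \<longlonglongrightarrow> 0"
  unfolding likelihood_error_def[abs_def] using assms by real_asymp

lemma measurable_dot_likelihood:
  "p \<ge> 2 \<Longrightarrow> dot_likelihood p k \<in> borel_measurable borel"
  unfolding dot_likelihood_def[abs_def] using measurable_lat_mgf[of p, measurable] by measurable

lemma integrable_dot_likelihood:
  assumes "p \<ge> 2"
  shows "integrable (slope_measure p) (\<lambda>v. dot_likelihood p k (lat v))"
proof (rule integrable_slope_measure_lat[OF assms measurable_dot_likelihood[OF assms]])
  fix x :: real assume x: "\<bar>x\<bar> \<le> 1"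
  have "k\<^sup>2 * x / real p \<le> k\<^sup>2 * 1 / real p"
    using x by (intro divide_right_mono mult_left_mono) auto
  then have "exp (k\<^sup>2 * x / real p + 4 * k ^ 4 / real p ^ 3)
      \<le> exp (k\<^sup>2 / real p + 4 * k ^ 4 / real p ^ 3)"
    by simp
  moreover have "0 < dot_likelihood p k x"
    using dot_likelihood_bounds(1)[OF assms x] exp_gt_zero less_le_trans by blast
  ultimately show "\<bar>dot_likelihood p k x\<bar> \<le> exp (k\<^sup>2 / real p + 4 * k ^ 4 / real p ^ 3)"
    using dot_likelihood_bounds(2)[OF assms x, of k] by linarith
qed

text \<open>The pointwise bound is integrated through exponential moments of
  \<open>sqrt (real p) * lat v\<close>, which \<open>lat_mgf_le\<close> controls uniformly in p. The
  condition \<open>\<tau>\<^sup>2 \<le> real n\<close> gives the a \<le> 1 required by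
  \<open>sq_mult_exp_abs_le\<close>.\<close>

lemma integral_dot_likelihood_error:
  fixes n p :: nat
  assumes p: "p \<ge> 2" and n: "n \<ge> 1" "\<tau>\<^sup>2 \<le> real n"
  defines "k \<equiv> \<tau> * real p powr (3/4) / sqrt (real n)"
  shows "(\<integral>v. \<bar>real n * (dot_likelihood p k (lat v) - 1)
      - \<tau>\<^sup>2 * (sqrt (real p) * lat v)\<bar> \<partial>slope_measure p)
    \<le> likelihood_error \<tau> n"
proof -
  let ?M = "slope_measure p"
  interpret prob_space ?M using p by (rule prob_space_slope_measure)
  define a where "a = \<tau>\<^sup>2 / real n"
  have a: "0 \<le> a" "a \<le> 1" using n by (auto simp: a_def)
  define d where "d = 4 * \<tau> ^ 4 / (real n)\<^sup>2"
  have d: "d \<ge> 0" by (simp add: d_def)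
  have p0: "real p > 0" using p by simp
  have k2: "k\<^sup>2 = a * (real p * sqrt (real p))"
  proof -
    have "(real p powr (3/4))\<^sup>2 = real p powr (1 + 1/2)"
      by (simp only: power2_eq_square powr_add[symmetric]) simp
    also have "\<dots> = real p * sqrt (real p)"
      unfolding powr_add using p0 by (simp add: powr_half_sqrt)
    finally show ?thesis
      by (simp add: k_def a_def power_divide power_mult_distrib)
  qed
  have "k ^ 4 = (k\<^sup>2)\<^sup>2" by simp
  also have "\<dots> = a\<^sup>2 * real p ^ 3"
    unfolding k2 by (simp add: power_mult_distrib eval_nat_numeral)
  finally have k4: "k ^ 4 = a\<^sup>2 * real p ^ 3" .
  have mgf: "(\<integral>v. exp (c * (sqrt (real p) * lat v)) \<partial>?M) \<le> exp (c\<^sup>2 / 2)" for c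
    using lat_mgf_le[OF p, of "c * sqrt (real p)"] p0
    by (simp add: lat_mgf_def power_mult_distrib mult.assoc)
  have int: "integrable ?M (\<lambda>v. exp (c * (sqrt (real p) * lat v)))" for c
    using integrable_exp_lat[OF p, of "c * sqrt (real p)"] by (simp add: mult.assoc)
  define g where "g v = real n * ((exp d - 1) * exp (a * (sqrt (real p) * lat v)))
      + real n * a\<^sup>2 * (2 * (exp (2 * (sqrt (real p) * lat v))
          + exp ((- 2) * (sqrt (real p) * lat v))))" for v
  have pointwise: "\<bar>real n * (dot_likelihood p k (lat v) - 1) - \<tau>\<^sup>2 * (sqrt (real p) * lat v)\<bar>
      \<le> g v" for v
  proof -
    define s where "s = sqrt (real p) * lat v"
    have y: "k\<^sup>2 * lat v / real p = a * s"
      using p0 by (simp add: k2 s_def)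
    have dd: "4 * k ^ 4 / real p ^ 3 = d"
      using p0 by (simp add: k4 d_def a_def power_divide)
    have lv: "\<bar>lat v\<bar> \<le> 1" using abs_lat_less_1[of v] by simp
    have "\<bar>dot_likelihood p k (lat v) - 1 - a * s\<bar>
        \<le> (exp d - 1) * exp (a * s) + (a * s)\<^sup>2 * exp \<bar>a * s\<bar>"
      using dot_likelihood_bounds[OF p lv, of k] d unfolding y dd by (intro abs_minus_one_minus_le)
    also have "(a * s)\<^sup>2 * exp \<bar>a * s\<bar> = a\<^sup>2 * (s\<^sup>2 * exp (a * \<bar>s\<bar>))"
      using a by (simp add: power_mult_distrib abs_mult)
    also have "\<dots> \<le> a\<^sup>2 * (2 * (exp (2 * s) + exp (- 2 * s)))"
      using sq_mult_exp_abs_le[OF a, of s] by (intro mult_left_mono) auto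
    finally have "real n * \<bar>dot_likelihood p k (lat v) - 1 - a * s\<bar>
      \<le> real n * ((exp d - 1) * exp (a * s) + a\<^sup>2 * (2 * (exp (2 * s) + exp (- 2 * s))))"
      by (intro mult_left_mono) auto
    moreover have eq: "real n * (dot_likelihood p k (lat v) - 1) - \<tau>\<^sup>2 * s
        = real n * (dot_likelihood p k (lat v) - 1 - a * s)"
      using n by (simp add: a_def field_simps)
    ultimately show ?thesis
      unfolding g_def s_def[symmetric] eq by (simp only: abs_mult abs_of_nat distrib_left
          mult.assoc)
  qed
  have "(\<integral>v. \<bar>real n * (dot_likelihood p k (lat v) - 1) - \<tau>\<^sup>2 * (sqrt (real p) * lat v)\<bar> \<partial>?M)
      \<le> (\<integral>v. g v \<partial>?M)"
  proof (rule integral_mono[OF _ _ pointwise])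
    show "integrable ?M (\<lambda>v. \<bar>real n * (dot_likelihood p k (lat v) - 1)
        - \<tau>\<^sup>2 * (sqrt (real p) * lat v)\<bar>)"
      using integrable_dot_likelihood[OF p, of k] integrable_lat_power[OF p, of 1] by simp
    show "integrable ?M g"
      unfolding g_def[abs_def] using int[of a] int[of 2] int[of "- 2"] by simp
  qed
  also have "\<dots> = real n * ((exp d - 1) * (\<integral>v. exp (a * (sqrt (real p) * lat v)) \<partial>?M))
      + real n * a\<^sup>2 * (2 * ((\<integral>v. exp (2 * (sqrt (real p) * lat v)) \<partial>?M)
        + (\<integral>v. exp ((- 2) * (sqrt (real p) * lat v)) \<partial>?M)))"
    unfolding g_def using int[of a] int[of 2] int[of "- 2"] by simp
  also have "\<dots> \<le> real n * ((exp d - 1) * exp (a\<^sup>2 / 2)) + real n * a\<^sup>2 * (2 * (exp (2\<^sup>2 / 2)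
      + exp ((- 2)\<^sup>2 / 2)))"
    using d by (intro add_mono mult_left_mono mgf) auto
  also have "\<dots> = likelihood_error \<tau> n"
  proof -
    have "real n * a\<^sup>2 = \<tau> ^ 4 / real n"
      using n by (simp add: a_def power_divide) (simp add: power2_eq_square)
    moreover have "a\<^sup>2 / 2 = \<tau> ^ 4 / (2 * (real n)\<^sup>2)"
      by (simp add: a_def power_divide)
    ultimately show ?thesis by (simp add: likelihood_error_def d_def mult_ac)
  qed
  finally show ?thesis .
qed

section \<open>Truncated mean of a coordinate\<close>

lemma lat_le_iff: "lat v \<le> lat w \<longleftrightarrow> v \<le> w"
proof -
  have "lat v < lat w" if "v < w" for v w
  proof (rule DERIV_pos_imp_increasing[OF that])
    fix x
    have "(1 - (lat x)\<^sup>2) / sqrt (1 + x\<^sup>2) > 0"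
      using one_plus_square_pos[of x] by (simp add: one_minus_lat_sq)
    then show "\<exists>y. (lat has_real_derivative y) (at x) \<and> y > 0"
      using DERIV_lat by blast
  qed
  then show ?thesis by (metis less_le_not_le linorder_le_less_linear order_le_less)
qed

lemma obtain_lat_eq:
  assumes "\<bar>c\<bar> < 1"
  obtains b where "lat b = c" "1 + b\<^sup>2 = 1 / (1 - c\<^sup>2)"
proof
  define b where "b = c / sqrt (1 - c\<^sup>2)"
  have c: "1 - c\<^sup>2 > 0" using assms by (simp add: abs_square_less_1)
  have eq: "1 + b\<^sup>2 = 1 / (1 - c\<^sup>2)"
    using c by (simp add: b_def power_divide field_simps)
  show "1 + b\<^sup>2 = 1 / (1 - c\<^sup>2)" by (rule eq)
  show "lat b = c"
    unfolding lat_def eq using c by (simp add: b_def real_sqrt_divide)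
qed

text \<open>The case j = 0 of \<open>DERIV_lat_primitive\<close>: up to the factor -(p - 1), the
  density times \<open>lat v\<close> is an exact derivative, integrated up to b with lat b = c. For
  |c| \<ge> 1 the truncation keeps everything or nothing and both sides are 0; \<open>max 0\<close>
  encodes this because p - 1 \<ge> 1. The square root of a natural power expresses the exponent (p -
  1) / 2 even at base 0.\<close>

lemma integral_lat_atMost:
  assumes p: "p \<ge> 2"
  shows "(\<integral>v. indicator {..c} (lat v) * lat v \<partial>slope_measure p)
    = - sqrt ((max 0 (1 - c\<^sup>2)) ^ (p - 1)) / ((real p - 1) * slope_norm p)"
proof -
  have p1: "real p - 1 > 0" using p by simp
  consider "\<bar>c\<bar> < 1" | "c \<ge> 1" | "c \<le> -1" by linarith
  then show ?thesis
  proof cases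
    case 1
    obtain b where b: "lat b = c" "1 + b\<^sup>2 = 1 / (1 - c\<^sup>2)" using obtain_lat_eq[OF 1] by blast
    have c: "1 - c\<^sup>2 > 0" using 1 by (simp add: abs_square_less_1)
    let ?f = "\<lambda>v. (1 + v\<^sup>2) powr (- real p / 2) * (real 0 * lat v ^ (0 - 1) * (1 - (lat v)\<^sup>2)
        - (real p - 1) * lat v ^ (0 + 1))"
    have "(\<integral>v. indicator {..b} v * ?f v \<partial>lborel) = lat b ^ 0 * (1 + b\<^sup>2) powr ((1 - real p) / 2)
        - 0"
    proof (rule LBINT_FTC_atMost[OF DERIV_lat_primitive _ _ tendsto_lat_primitive(2)[OF p]])
      show "isCont ?f x" for x
        using one_plus_square_pos[of x] by (auto intro!: continuous_intros isCont_lat)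
      show "integrable lborel ?f"
        by (rule integrable_slope_density_mult[OF p _ lat_primitive_bound]) measurable
    qed
    moreover have "(\<integral>v. indicator {..b} v * ?f v \<partial>lborel)
        = - (real p - 1) * (\<integral>v. (1 + v\<^sup>2) powr (- real p / 2) * (indicator {..c} (lat v)
            * lat v) \<partial>lborel)"
    proof -
      have "indicator {..b} v * ?f v
          = - (real p - 1) * ((1 + v\<^sup>2) powr (- real p / 2) * (indicator {..c} (lat v)
              * lat v))" for v
        using lat_le_iff[of v b] by (auto simp: b(1) indicator_def algebra_simps)
      then show ?thesis by (simp only: integral_mult_right_zero)
    qed
    moreover have "(1 + b\<^sup>2) powr ((1 - real p) / 2) = sqrt ((1 - c\<^sup>2) ^ (p - 1))"
    proof -
      have "(1 + b\<^sup>2) powr ((1 - real p) / 2) = (1 - c\<^sup>2) powr (real (p - 1) / 2)"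
        unfolding b(2) using c p by (simp add: powr_divide powr_minus[symmetric] of_nat_diff
            divide_powr_uminus minus_divide_left)
      also have "\<dots> = sqrt ((1 - c\<^sup>2) ^ (p - 1))"
        using c by (simp only: powr_half_sqrt_powr powr_realpow less_imp_le)
      finally show ?thesis .
    qed
    ultimately have "(\<integral>v. (1 + v\<^sup>2) powr (- real p / 2) * (indicator {..c} (lat v) * lat v) \<partial>lborel)
        = - sqrt ((1 - c\<^sup>2) ^ (p - 1)) / (real p - 1)"
      using p1 by (simp add: field_simps)
    then show ?thesis using c p
      by (subst integral_slope_measure) (auto simp: max_def)
  next
    case 2
    then have "1 \<le> c\<^sup>2" by (simp add: one_le_power)
    moreover have "indicator {..c} (lat v) = (1 :: real)" for v
      using abs_lat_less_1[of v] 2 by (simp add: abs_less_iff)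
    ultimately show ?thesis
      using lat_moment_odd[OF p, of 0] p by (simp add: max_def power_0_left)
  next
    case 3
    then have "1 \<le> c\<^sup>2" using one_le_power[of "- c" 2] by simp
    moreover have "indicator {..c} (lat v) = (0 :: real)" for v
      using abs_lat_less_1[of v] 3 by (simp add: abs_less_iff)
    ultimately show ?thesis using p by (simp add: max_def power_0_left)
  qed
qed

section \<open>Gaussian limits of the normalizing constant and of the kernel\<close>

text \<open>A majorant independent of p, for dominated convergence. Bernoulli's inequality is
  applied with the integer exponent m = p div 2; the factor 4 comes from p \<le> 4 m, valid for p
  \<ge> 2.\<close>

lemma student_kernel_le:
  assumes "p \<ge> 2"
  shows "(1 + w\<^sup>2 / real p) powr (- real p / 2) \<le> 4 * inverse (1 + w\<^sup>2)"
proof -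
  define m where "m = p div 2"
  have m: "real p \<le> 4 * real m" "real m \<le> real p / 2"
    using assms by (simp_all add: m_def)
  have "w\<^sup>2 * real p \<le> w\<^sup>2 * (4 * real m)" using m by (intro mult_left_mono) auto
  then have "1 + w\<^sup>2 / 4 \<le> 1 + real m * (w\<^sup>2 / real p)"
    using assms by (simp add: field_simps)
  also have "\<dots> \<le> (1 + w\<^sup>2 / real p) ^ m"
    by (rule Bernoulli_inequality) (rule order_trans[of _ 0], auto)
  also have "\<dots> = (1 + w\<^sup>2 / real p) powr real m"
    by (subst powr_realpow) (auto intro: add_pos_nonneg)
  also have "\<dots> \<le> (1 + w\<^sup>2 / real p) powr (real p / 2)"
    using m by (intro powr_mono) auto
  finally have "inverse ((1 + w\<^sup>2 / real p) powr (real p / 2)) \<le> inverse (1 + w\<^sup>2 / 4)"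
    by (intro le_imp_inverse_le) (auto intro: add_pos_nonneg)
  also have "\<dots> \<le> 4 * inverse (1 + w\<^sup>2)"
    by (simp add: divide_simps add_pos_nonneg)
  finally show ?thesis by (simp add: powr_minus)
qed

lemma LBINT_gaussian: "(\<integral>w. exp (- w\<^sup>2 / 2) \<partial>lborel) = sqrt (2 * pi)"
proof -
  have "(\<integral>w. 1 / sqrt (2 * pi) * exp (- w\<^sup>2 / 2) \<partial>lborel) = 1"
    unfolding std_normal_density_def[symmetric] using integral_std_normal_moment_even[of 0] by simp
  then have eq: "1 / sqrt (2 * pi) * (\<integral>w. exp (- w\<^sup>2 / 2) \<partial>lborel) = 1"
    by (simp only: integral_mult_right_zero)
  have "(\<integral>w. exp (- w\<^sup>2 / 2) \<partial>lborel) = sqrt (2 * pi) * (1 / sqrt (2 * pi)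
      * (\<integral>w. exp (- w\<^sup>2 / 2) \<partial>lborel))"
    by simp
  then show ?thesis by (simp only: eq mult_1_right)
qed

text \<open>The substitution v = w / sqrt p gives the integrand (1 + w^2 / p) powr (-p/2), which
  tends to exp (- w^2 / 2). The index is shifted by 2 so that the majorant holds for every
  term.\<close>

lemma slope_norm_asymp: "(\<lambda>p. sqrt (real p) * slope_norm p) \<longlonglongrightarrow> sqrt (2 * pi)"
proof -
  have scale: "sqrt (real p) * slope_norm p = (\<integral>w. (1 + w\<^sup>2 / real p) powr (- real p / 2) \<partial>lborel)"
    if "p \<ge> 2" for p
    using that lborel_integral_real_affine[of "1 / sqrt (real p)" "\<lambda>v. (1
        + v\<^sup>2) powr (- real p / 2)" 0]
    by (simp add: power_divide)
  have "(\<lambda>i. \<integral>w. (1 + w\<^sup>2 / real (i + 2)) powr (- real (i + 2) / 2) \<partial>lborel)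
      \<longlonglongrightarrow> (\<integral>w. exp (- w\<^sup>2 / 2) \<partial>lborel)"
  proof (rule integral_dominated_convergence)
    show "integrable lborel (\<lambda>w::real. 4 * inverse (1 + w\<^sup>2))"
      using integrable_inverse_1_plus_square by (simp add: set_integrable_def)
    show "AE w in lborel. norm ((1 + w\<^sup>2 / real (i + 2)) powr (- real (i + 2) / 2))
        \<le> 4 * inverse (1 + w\<^sup>2)" for i
      using student_kernel_le[of "i + 2"] by simp
    have lim: "(\<lambda>p. (1 + x / real p) powr (- real p / 2)) \<longlonglongrightarrow> exp (- x / 2)" for x :: real
      by real_asymp
    show "AE w in lborel. (\<lambda>i. (1 + w\<^sup>2 / real (i + 2)) powr (- real (i
        + 2) / 2)) \<longlonglongrightarrow> exp (- w\<^sup>2 / 2)"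
      by (intro AE_I2 LIMSEQ_ignore_initial_segment[OF lim])
  qed measurable
  then have "(\<lambda>i. sqrt (real (i + 2)) * slope_norm (i + 2)) \<longlonglongrightarrow> sqrt (2 * pi)"
    using scale by (simp only: LBINT_gaussian le_add2)
  then show ?thesis by (rule LIMSEQ_offset)
qed

text \<open>Put z = y / m. Above, 1 - z \<le> exp (- z). Below, 1 - z \<ge> exp (- z) (1 - z^2) for
  z \<le> 1, and Bernoulli's inequality gives (1 - z^2)^m \<ge> 1 - y^2 / m; the loss y^2 exp (- y)
  / m is at most 2 / m. For z > 1 the lower estimate is at most 0.\<close>

lemma power_one_minus_approx_exp:
  fixes y :: real
  assumes "y \<ge> 0" "m \<ge> 1"
  shows "\<bar>(max 0 (1 - y / real m)) ^ m - exp (- y)\<bar> \<le> 2 / real m"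
proof -
  define z where "z = y / real m"
  have z: "z \<ge> 0" "real m * z = y" using assms by (simp_all add: z_def)
  have exp_pow: "exp (- z) ^ m = exp (- y)"
    using z by (simp add: exp_of_nat_mult[symmetric])
  have "max 0 (1 - z) \<le> exp (- z)" using exp_ge_add_one_self[of "- z"] by simp
  then have "(max 0 (1 - z)) ^ m \<le> exp (- z) ^ m" by (intro power_mono) auto
  then have up: "(max 0 (1 - z)) ^ m \<le> exp (- y)" by (simp only: exp_pow)
  have "y\<^sup>2 \<le> 2 * exp y" using exp_lower_Taylor_quadratic[OF assms(1)] assms(1) by simp
  then have "y\<^sup>2 * exp (- y) \<le> 2" by (simp add: exp_minus field_simps)
  then have tail: "exp (- y) * (y\<^sup>2 / real m) \<le> 2 / real m"
    by (simp add: divide_right_mono mult.commute)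
  have low: "exp (- y) * (1 - y\<^sup>2 / real m) \<le> (max 0 (1 - z)) ^ m"
  proof (cases "z \<le> 1")
    case True
    have "exp (- z) * (1 + z) \<le> exp (- z) * exp z"
      using exp_ge_add_one_self[of z] by (intro mult_left_mono) auto
    then have "(exp (- z) * (1 + z)) * (1 - z) \<le> 1 * (1 - z)"
      using True by (intro mult_right_mono) (auto simp: exp_minus)
    then have step: "exp (- z) * (1 - z\<^sup>2) \<le> 1 - z" by (simp add: algebra_simps power2_eq_square)
    have "z\<^sup>2 \<le> 1" using True z by (simp add: power_le_one)
    have "1 - y\<^sup>2 / real m = 1 + real m * (- z\<^sup>2)"
      using assms z by (simp add: z_def power_divide power2_eq_square)
    also have "\<dots> \<le> (1 + - z\<^sup>2) ^ m"
      using \<open>z\<^sup>2 \<le> 1\<close> by (intro Bernoulli_inequality) simp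
    finally have "exp (- y) * (1 - y\<^sup>2 / real m) \<le> exp (- z) ^ m * (1 - z\<^sup>2) ^ m"
      unfolding exp_pow by (intro mult_left_mono) auto
    also have "\<dots> = (exp (- z) * (1 - z\<^sup>2)) ^ m" by (simp add: power_mult_distrib)
    also have "\<dots> \<le> (1 - z) ^ m"
      using step \<open>z\<^sup>2 \<le> 1\<close> by (intro power_mono) auto
    finally show ?thesis using True by simp
  next
    case False
    then have "y \<ge> real m" using assms by (simp add: z_def field_simps)
    then have "y\<^sup>2 \<ge> real m * 1" unfolding power2_eq_square using assms by (intro mult_mono) auto
    then have "1 - y\<^sup>2 / real m \<le> 0" using assms by (simp add: field_simps)
    then have "exp (- y) * (1 - y\<^sup>2 / real m) \<le> 0" by (simp add: mult_nonneg_nonpos)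
    also have "0 \<le> (max 0 (1 - z)) ^ m" by simp
    finally show ?thesis .
  qed
  show ?thesis
    using up low tail unfolding z_def by (simp add: abs_le_iff algebra_simps)
qed

text \<open>Hoelder continuity of the square root carries a uniform error through
  \<open>sqrt\<close> even where the arguments approach 0.\<close>

lemma abs_sqrt_diff_le:
  assumes "a \<ge> 0" "b \<ge> 0"
  shows "\<bar>sqrt a - sqrt b\<bar> \<le> sqrt \<bar>a - b\<bar>"
proof (rule real_le_rsqrt)
  have "(sqrt a - sqrt b)\<^sup>2 = \<bar>sqrt a - sqrt b\<bar> * \<bar>sqrt a - sqrt b\<bar>"
    by (simp add: power2_eq_square)
  also have "\<dots> \<le> \<bar>sqrt a - sqrt b\<bar> * \<bar>sqrt a + sqrt b\<bar>"
    using assms by (intro mult_left_mono) (auto simp: abs_le_iff)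
  also have "\<dots> = \<bar>(sqrt a - sqrt b) * (sqrt a + sqrt b)\<bar>" by (simp add: abs_mult)
  also have "(sqrt a - sqrt b) * (sqrt a + sqrt b) = a - b"
    using assms by (simp add: algebra_simps)
  finally show "\<bar>sqrt a - sqrt b\<bar>\<^sup>2 \<le> \<bar>a - b\<bar>" by simp
qed

definition kernel_error :: "nat \<Rightarrow> real" where
  "kernel_error p = sqrt (2 / (real p - 1)) + 1 / (real p - 1)"

text \<open>The first term of \<open>kernel_error\<close> is the error of the power with m = p - 1,
  passed through the square root; the second pays for replacing (p - 1) / p by 1 in the
  exponent.\<close>

lemma sqrt_power_approx_exp:
  fixes x :: real
  assumes "x \<ge> 0" "p \<ge> 2"
  shows "\<bar>sqrt ((max 0 (1 - x / real p)) ^ (p - 1)) - exp (- x / 2)\<bar> \<le> kernel_error p"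
proof -
  define m where "m = p - 1"
  have m: "m \<ge> 1" "real m = real p - 1" using assms by (auto simp: m_def)
  define y where "y = real m * x / real p"
  have y: "y \<ge> 0" "y / real m = x / real p" using assms m by (simp_all add: y_def)
  have "\<bar>sqrt ((max 0 (1 - x / real p)) ^ m) - sqrt (exp (- y))\<bar>
      \<le> sqrt \<bar>(max 0 (1 - x / real p)) ^ m - exp (- y)\<bar>"
    by (rule abs_sqrt_diff_le) auto
  also have "\<dots> \<le> sqrt (2 / real m)"
    using power_one_minus_approx_exp[OF y(1) m(1)] by (simp only: y(2) real_sqrt_le_iff)
  finally have 1: "\<bar>sqrt ((max 0 (1 - x / real p)) ^ m) - sqrt (exp (- y))\<bar> \<le> sqrt (2 / real m)" .
  have half: "sqrt (exp (- y)) = exp (- y / 2)"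
    by (rule real_sqrt_unique) (simp_all add: exp_double[symmetric])
  \<comment> \<open>Since 1 - m / p = 1 / p, the gap is x / (2p), which is y / (2m).\<close>
  have e: "x / 2 - y / 2 = (y / 2) / real m"
    using assms m by (simp add: y_def divide_simps) (simp add: algebra_simps)
  have "1 - (x / 2 - y / 2) \<le> exp (- (x / 2 - y / 2))"
    using exp_ge_add_one_self[of "- (x / 2 - y / 2)"] by linarith
  then have "exp (- y / 2) * (1 - (x / 2 - y / 2)) \<le> exp (- y / 2) * exp (- (x / 2 - y / 2))"
    by (intro mult_left_mono) auto
  also have "\<dots> = exp (- x / 2)" by (simp add: exp_add[symmetric])
  finally have "exp (- y / 2) - exp (- x / 2) \<le> (y / 2 * exp (- y / 2)) / real m"
    unfolding e by (simp add: algebra_simps)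
  also have "y / 2 * exp (- y / 2) \<le> 1"
    using exp_ge_add_one_self[of "y / 2"] y by (simp add: exp_minus field_simps)
  finally have "exp (- y / 2) - exp (- x / 2) \<le> 1 / real m" by (simp add: divide_right_mono)
  moreover have "(y / 2) / real m \<ge> 0" using y by simp
  then have "y \<le> x" using e by linarith
  then have "exp (- x / 2) \<le> exp (- y / 2)" by simp
  ultimately have 2: "\<bar>exp (- y / 2) - exp (- x / 2)\<bar> \<le> 1 / real m" by simp
  show ?thesis
    using 1 2 unfolding half kernel_error_def m(2) m_def[symmetric] by linarith
qed

text \<open>Minus the mean of sqrt p T truncated to T \<le> 0; its limit is the standard normal
  density at 0.\<close>

definition truncated_mean_coeff :: "nat \<Rightarrow> real" where
  "truncated_mean_coeff p = sqrt (real p) / ((real p - 1) * slope_norm p)"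

lemma truncated_mean_coeff_tendsto: "truncated_mean_coeff \<longlonglongrightarrow> 1 / sqrt (2 * pi)"
proof -
  have "(\<lambda>p. real p / (real p - 1)) \<longlonglongrightarrow> 1" by real_asymp
  from tendsto_divide[OF this slope_norm_asymp]
  have "(\<lambda>p. real p / (real p - 1) / (sqrt (real p) * slope_norm p)) \<longlonglongrightarrow> 1 / sqrt (2 * pi)"
    by simp
  moreover have "real p / (real p - 1) / (sqrt (real p) * slope_norm p)
      = truncated_mean_coeff p" for p
  proof -
    have "real p / sqrt (real p) = sqrt (real p)" by (simp add: real_div_sqrt)
    moreover have "real p / (real p - 1) / (sqrt (real p) * slope_norm p)
        = (real p / sqrt (real p)) / ((real p - 1) * slope_norm p)"
      by (simp only: divide_divide_eq_left mult_ac)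
    ultimately show ?thesis by (simp only: truncated_mean_coeff_def)
  qed
  ultimately show ?thesis by simp
qed

lemma kernel_error_tendsto: "kernel_error \<longlonglongrightarrow> 0"
  unfolding kernel_error_def[abs_def] by real_asymp

section \<open>Combination of the errors and the limit theorem\<close>

definition total_error :: "real \<Rightarrow> nat \<Rightarrow> nat \<Rightarrow> real" where
  "total_error \<tau> n p = likelihood_error \<tau> n + \<tau>\<^sup>2 * (\<bar>truncated_mean_coeff p\<bar> * kernel_error p
    + \<bar>truncated_mean_coeff p - 1 / sqrt (2 * pi)\<bar>)"

text \<open>The probability difference is E (I (h - 1)) with I the indicator of T \<le> u / sqrt p.
  Replacing n (h - 1) by \<tau>^2 sqrt p T costs at most the L^1 error, whatever I is, and the
  remaining truncated mean is explicit. Hence the bound is free of u and \<theta>.\<close>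

lemma prob_difference_bound:
  fixes n p :: nat
  assumes p: "p \<ge> 2" and n: "n \<ge> 1" "\<tau>\<^sup>2 \<le> real n" and \<theta>: "\<theta> \<in> unit_sphere p"
  defines "\<mu> \<equiv> fvml p (\<tau> * real p powr (3/4) / sqrt (real n)) \<theta>"
  shows "\<bar>real n * (\<P>((x, y) in \<mu> \<Otimes>\<^sub>M \<mu>. sqrt (real p) * dot p x y \<le> u)
      - \<P>((x, y) in uniform_sphere p \<Otimes>\<^sub>M uniform_sphere p. sqrt (real p) * dot p x y \<le> u))
      - - \<tau>\<^sup>2 / sqrt (2 * pi) * exp (- u\<^sup>2 / 2)\<bar> \<le> total_error \<tau> n p"
proof -
  let ?M = "slope_measure p"
  interpret prob_space ?M using p by (rule prob_space_slope_measure)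
  define k where "k = \<tau> * real p powr (3/4) / sqrt (real n)"
  define c where "c = u / sqrt (real p)"
  define h where "h v = dot_likelihood p k (lat v)" for v
  define I where "I v = (indicator {..c} (lat v) :: real)" for v
  have le_iff: "sqrt (real p) * d \<le> u \<longleftrightarrow> d \<le> c" for d
    using p by (simp add: c_def pos_le_divide_eq mult.commute)
  have mu: "\<P>((x, y) in \<mu> \<Otimes>\<^sub>M \<mu>. sqrt (real p) * dot p x y \<le> u) = (\<integral>v. I v * h v \<partial>?M)"
    unfolding le_iff \<mu>_def k_def[symmetric] prob_dot_fvml[OF p \<theta>] I_def h_def dot_likelihood_def ..
  have unif: "\<P>((x, y) in uniform_sphere p \<Otimes>\<^sub>M uniform_sphere p. sqrt (real p) * dot p x y \<le> u)
      = (\<integral>v. I v \<partial>?M)"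
    unfolding le_iff prob_dot_uniform_sphere[OF p] I_def ..
  have I_meas[measurable]: "I \<in> borel_measurable borel" unfolding I_def[abs_def] by measurable
  have I_bound: "\<bar>I v\<bar> \<le> 1" for v by (simp add: I_def indicator_def)
  have I_mult: "integrable ?M (\<lambda>v. I v * f v)" if "integrable ?M f" for f :: "real \<Rightarrow> real"
    using that by (rule Bochner_Integration.integrable_bound)
      (use that I_bound in \<open>auto simp: abs_mult intro!: mult_left_le_one_le\<close>)
  have h_int: "integrable ?M h"
    unfolding h_def by (rule integrable_dot_likelihood[OF p])
  have lat_int: "integrable ?M lat"
    using integrable_lat_power[OF p, of 1] by simp
  have I_int: "integrable ?M I" using I_mult[of "\<lambda>_. 1"] by simp
  define G where "G v = real n * (h v - 1) - \<tau>\<^sup>2 * (sqrt (real p) * lat v)" for v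
  have G_int: "integrable ?M G" unfolding G_def[abs_def] using h_int lat_int by simp
  have trunc: "\<tau>\<^sup>2 * (sqrt (real p) * (\<integral>v. I v * lat v \<partial>?M))
      = - \<tau>\<^sup>2 * (truncated_mean_coeff p * sqrt ((max 0 (1 - u\<^sup>2 / real p)) ^ (p - 1)))"
    unfolding I_def integral_lat_atMost[OF p] truncated_mean_coeff_def
    by (simp add: c_def power_divide)
  have "real n * ((\<integral>v. I v * h v \<partial>?M) - (\<integral>v. I v \<partial>?M)) - \<tau>\<^sup>2 * (sqrt (real p) * (\<integral>v. I v
      * lat v \<partial>?M))
      = (\<integral>v. real n * (I v * h v - I v) - \<tau>\<^sup>2 * (sqrt (real p) * (I v * lat v)) \<partial>?M)"
    using I_mult[OF h_int] I_mult[OF lat_int] I_int by simp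
  also have "\<dots> = (\<integral>v. I v * G v \<partial>?M)"
    by (intro Bochner_Integration.integral_cong) (simp_all add: G_def algebra_simps)
  finally have split: "real n * ((\<integral>v. I v * h v \<partial>?M) - (\<integral>v. I v \<partial>?M))
      = (\<integral>v. I v * G v \<partial>?M) + \<tau>\<^sup>2 * (sqrt (real p) * (\<integral>v. I v * lat v \<partial>?M))"
    by simp
  have "\<bar>\<integral>v. I v * G v \<partial>?M\<bar> \<le> (\<integral>v. \<bar>I v * G v\<bar> \<partial>?M)"
    by (rule integral_abs_bound)
  also have "\<dots> \<le> (\<integral>v. \<bar>G v\<bar> \<partial>?M)"
    by (intro integral_mono integrable_abs I_mult G_int)
      (auto simp: abs_mult intro!: mult_left_le_one_le I_bound)
  also have "\<dots> \<le> likelihood_error \<tau> n"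
    unfolding G_def h_def k_def by (rule integral_dot_likelihood_error[OF p n])
  finally have G_le: "\<bar>\<integral>v. I v * G v \<partial>?M\<bar> \<le> likelihood_error \<tau> n" .
  define s where "s = sqrt ((max 0 (1 - u\<^sup>2 / real p)) ^ (p - 1))"
  define E where "E = exp (- u\<^sup>2 / 2)"
  define r where "r = truncated_mean_coeff p"
  have "\<bar>s - E\<bar> \<le> kernel_error p"
    unfolding s_def E_def using sqrt_power_approx_exp[of "u\<^sup>2" p] p by simp
  then have 1: "\<bar>r * (s - E)\<bar> \<le> \<bar>r\<bar> * kernel_error p"
    unfolding abs_mult by (intro mult_left_mono) auto
  have 2: "\<bar>(r - 1 / sqrt (2 * pi)) * E\<bar> \<le> \<bar>r - 1 / sqrt (2 * pi)\<bar>"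
    unfolding abs_mult by (rule mult_left_le) (auto simp: E_def)
  have 3: "r * s - 1 / sqrt (2 * pi) * E = r * (s - E) + (r - 1 / sqrt (2 * pi)) * E"
    by (simp add: algebra_simps)
  have "\<bar>r * s - 1 / sqrt (2 * pi) * E\<bar> \<le> \<bar>r\<bar> * kernel_error p + \<bar>r - 1 / sqrt (2 * pi)\<bar>"
    unfolding 3 by (rule order_trans[OF abs_triangle_ineq add_mono[OF 1 2]])
  then have 4: "\<bar>\<tau>\<^sup>2 * (r * s - 1 / sqrt (2 * pi) * E)\<bar>
      \<le> \<tau>\<^sup>2 * (\<bar>r\<bar> * kernel_error p + \<bar>r - 1 / sqrt (2 * pi)\<bar>)"
    unfolding abs_mult[of "\<tau>\<^sup>2"] by (simp add: mult_left_mono)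
  have 5: "(\<integral>v. I v * G v \<partial>?M) + - \<tau>\<^sup>2 * (r * s) - - \<tau>\<^sup>2 / sqrt (2 * pi) * E
      = (\<integral>v. I v * G v \<partial>?M) - \<tau>\<^sup>2 * (r * s - 1 / sqrt (2 * pi) * E)"
    by (simp add: algebra_simps)
  show ?thesis
    unfolding mu unif split trunc total_error_def E_def[symmetric] s_def[symmetric]
        r_def[symmetric] 5
    by (rule order_trans[OF abs_triangle_ineq4 add_mono[OF G_le 4]])
qed

lemma total_error_tendsto:
  assumes "\<tau> > 0" "filterlim p at_top sequentially"
  shows "(\<lambda>n. total_error \<tau> n (p n)) \<longlonglongrightarrow> 0"
proof -
  note coeff = filterlim_compose[OF truncated_mean_coeff_tendsto assms(2)]
  note kern = filterlim_compose[OF kernel_error_tendsto assms(2)]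
  have "(\<lambda>n. total_error \<tau> n (p n)) \<longlonglongrightarrow> 0 + \<tau>\<^sup>2 * (\<bar>1 / sqrt (2 * pi)\<bar> * 0
      + \<bar>1 / sqrt (2 * pi) - 1 / sqrt (2 * pi)\<bar>)"
    unfolding total_error_def by (intro tendsto_intros likelihood_error_tendsto assms coeff kern)
  then show ?thesis by simp
qed

text \<open>A single error \<omega> n, valid for all u at once, yields the three claims.\<close>

theorem proposition2:
  fixes \<tau> :: real
    and p :: "nat \<Rightarrow> nat"
    and \<theta> :: "nat \<Rightarrow> nat \<Rightarrow> real"
    and \<mu> :: "nat \<Rightarrow> (nat \<Rightarrow> real) measure"
    and D :: "nat \<Rightarrow> real \<Rightarrow> real"
  assumes "\<tau> > 0"
    and "\<And>n. n \<ge> 1 \<Longrightarrow> \<theta> n \<in> unit_sphere (p n)"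
    and "\<And>n. n \<ge> 1 \<Longrightarrow> \<mu> n = fvml (p n) (\<tau> * real (p n) powr (3/4) / sqrt (real n)) (\<theta> n)"
    and "\<And>n u. n \<ge> 1 \<Longrightarrow> D n u =
      real n * (\<P>((x, y) in \<mu> n \<Otimes>\<^sub>M \<mu> n. sqrt (real (p n)) * dot (p n) x y \<le> u)
        - \<P>((x, y) in uniform_sphere (p n) \<Otimes>\<^sub>M uniform_sphere (p n).
             sqrt (real (p n)) * dot (p n) x y \<le> u))"
    and "filterlim (\<lambda>n. min n (p n)) at_top sequentially"
  shows "(\<forall>u. (\<lambda>n. D n u) \<longlonglongrightarrow> - \<tau>\<^sup>2 / sqrt (2 * pi) * exp (- u\<^sup>2 / 2))
    \<and> uniform_limit UNIV D (\<lambda>u. - \<tau>\<^sup>2 / sqrt (2 * pi) * exp (- u\<^sup>2 / 2)) sequentially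
    \<and> (\<lambda>n. real n * dot_dist (p n) (\<mu> n) (uniform_sphere (p n)))
        \<longlonglongrightarrow> \<tau>\<^sup>2 / sqrt (2 * pi)"
proof -
  define L where "L u = - \<tau>\<^sup>2 / sqrt (2 * pi) * exp (- u\<^sup>2 / 2)" for u
  define \<omega> where "\<omega> n = total_error \<tau> n (p n)" for n
  have p_top: "filterlim p at_top sequentially"
    by (rule filterlim_at_top_mono[OF assms(5)]) simp
  have \<omega>: "\<omega> \<longlonglongrightarrow> 0"
    unfolding \<omega>_def[abs_def] by (rule total_error_tendsto[OF assms(1) p_top])
  have "\<forall>\<^sub>F n in sequentially. \<tau>\<^sup>2 \<le> real n"
    using filterlim_real_sequentially by (simp add: filterlim_at_top)
  moreover have "\<forall>\<^sub>F n in sequentially. p n \<ge> 2"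
    using p_top by (simp add: filterlim_at_top)
  ultimately have good: "\<forall>\<^sub>F n in sequentially. n \<ge> 1 \<and> p n \<ge> 2 \<and> \<tau>\<^sup>2 \<le> real n"
    using eventually_ge_at_top[of 1] by eventually_elim auto
  have D_bound: "\<bar>D n u - L u\<bar> \<le> \<omega> n" if "n \<ge> 1 \<and> p n \<ge> 2 \<and> \<tau>\<^sup>2 \<le> real n" for n u
    using prob_difference_bound[of "p n" n \<tau> "\<theta> n" u] that assms(2)[of n]
    by (simp add: assms(3,4) L_def \<omega>_def)
  have unif: "uniform_limit UNIV D L sequentially"
  proof (rule uniform_limitI)
    fix e :: real assume "e > 0"
    then have "\<forall>\<^sub>F n in sequentially. \<omega> n < e" using \<omega> by (intro order_tendstoD)
    with good show "\<forall>\<^sub>F n in sequentially. \<forall>u\<in>UNIV. dist (D n u) (L u) < e"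
    proof eventually_elim
      case (elim n)
      then show ?case using D_bound[of n] by (auto simp: dist_real_def intro: le_less_trans)
    qed
  qed
  have L_abs: "\<bar>L u\<bar> \<le> \<tau>\<^sup>2 / sqrt (2 * pi)" for u
  proof -
    have "\<bar>L u\<bar> = \<tau>\<^sup>2 / sqrt (2 * pi) * exp (- u\<^sup>2 / 2)" by (simp add: L_def abs_mult)
    also have "\<dots> \<le> \<tau>\<^sup>2 / sqrt (2 * pi) * 1" by (intro mult_left_mono) auto
    finally show ?thesis by simp
  qed
  have dist_bound: "\<bar>real n * dot_dist (p n) (\<mu> n) (uniform_sphere (p n)) - \<tau>\<^sup>2 / sqrt (2 * pi)\<bar>
      \<le> \<omega> n"
    if n: "n \<ge> 1 \<and> p n \<ge> 2 \<and> \<tau>\<^sup>2 \<le> real n" for n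
  proof -
    define a where "a t = \<bar>\<P>((x, y) in \<mu> n \<Otimes>\<^sub>M \<mu> n. dot (p n) x y \<le> t)
      - \<P>((x, y) in uniform_sphere (p n) \<Otimes>\<^sub>M uniform_sphere (p n). dot (p n) x y \<le> t)\<bar>" for t
    have sqrt_p: "sqrt (real (p n)) > 0" using n by simp
    have na: "real n * a t = \<bar>D n (sqrt (real (p n)) * t)\<bar>" for t
      using n sqrt_p by (simp add: a_def assms(4) abs_mult)
    have a_le: "a t \<le> (\<tau>\<^sup>2 / sqrt (2 * pi) + \<omega> n) / real n" for t
    proof -
      have "real n * a t \<le> \<tau>\<^sup>2 / sqrt (2 * pi) + \<omega> n"
        using D_bound[OF n, of "sqrt (real (p n)) * t"] L_abs[of "sqrt (real (p n)) * t"]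
        unfolding na by linarith
      then show ?thesis using n by (simp add: pos_le_divide_eq mult.commute)
    qed
    have dist: "dot_dist (p n) (\<mu> n) (uniform_sphere (p n)) = (SUP t\<in>{-1..1}. a t)"
      by (simp add: dot_dist_def a_def)
    have "(SUP t\<in>{-1..1}. a t) \<le> (\<tau>\<^sup>2 / sqrt (2 * pi) + \<omega> n) / real n"
      by (intro cSUP_least a_le) auto
    then have upper: "real n * (SUP t\<in>{-1..1}. a t) \<le> \<tau>\<^sup>2 / sqrt (2 * pi) + \<omega> n"
      using n by (simp add: pos_le_divide_eq mult.commute)
    \<comment> \<open>The limit profile |L| peaks at u = 0, which corresponds to t = 0 for every p,
      so this one point supplies the lower bound matching the uniform upper one.\<close>
    have "a 0 \<le> (SUP t\<in>{-1..1}. a t)"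
      using a_le by (intro cSUP_upper bdd_aboveI2) auto
    then have "real n * a 0 \<le> real n * (SUP t\<in>{-1..1}. a t)"
      by (intro mult_left_mono) auto
    moreover have "\<tau>\<^sup>2 / sqrt (2 * pi) - \<omega> n \<le> real n * a 0"
      unfolding na using D_bound[OF n, of 0] by (simp add: L_def)
    ultimately show ?thesis unfolding dist using upper by linarith
  qed
  have "(\<lambda>n. real n * dot_dist (p n) (\<mu> n) (uniform_sphere (p n)) - \<tau>\<^sup>2 / sqrt (2 * pi)) \<longlonglongrightarrow> 0"
    by (rule Lim_null_comparison[OF _ \<omega>]) (use good in eventually_elim, use dist_bound in simp)
  then have "(\<lambda>n. real n * dot_dist (p n) (\<mu> n) (uniform_sphere (p n))) \<longlonglongrightarrow> \<tau>\<^sup>2 / sqrt (2 * pi)"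
    by (rule LIM_zero_cancel)
  moreover have "(\<lambda>n. D n u) \<longlonglongrightarrow> L u" for u
    using unif by (rule tendsto_uniform_limitI) simp
  ultimately show ?thesis using unif unfolding L_def by auto
qed

end
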